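(* For every integer $n\geq 5$, $\mathrm{ex}_{\mathcal P}(n,\Theta_4^{\mathrm{ind}})\leq \frac{8}{3}(n-2)$. Moreover, this bound is sharp (attained with equality) for every $n\equiv 20 \pmod{36}$.
   Context: All graphs are finite and simple. A graph $G$ is $F^{\mathrm{ind}}$-free if it contains no induced subgraph isomorphic to $F$. The induced planar Turán number is $\mathrm{ex}_{\mathcal P}(n,F^{\mathrm{ind}}):=\max\{|E(G)| : G \text{ is an } n\text{-vertex planar graph that is } F^{\mathrm{ind}}\text{-free}\}$. $\Theta_4$ denotes the 4-cycle together with one diagonal edge (4 vertices, 5 edges). *)

theory Defs
  imports "HOL-Analysis.Analysis"
begin

definition simple_graph :: "'a set \<Rightarrow> 'a set set \<Rightarrow> bool" where
  "simple_graph V E \<longleftrightarrow> finite V \<and> (\<forall>e\<in>E. e \<subseteq> V \<and> card e = 2)"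

definition induced_edges :: "'a set set \<Rightarrow> 'a set \<Rightarrow> 'a set set" where
  "induced_edges E S = {e \<in> E. e \<subseteq> S}"

definition graph_iso :: "'a set \<Rightarrow> 'a set set \<Rightarrow> 'b set \<Rightarrow> 'b set set \<Rightarrow> bool" where
  "graph_iso V E W F \<longleftrightarrow>
     (\<exists>f. bij_betw f V W \<and> (\<forall>u\<in>V. \<forall>v\<in>V. {u, v} \<in> E \<longleftrightarrow> {f u, f v} \<in> F))"

definition induced_free :: "'a set \<Rightarrow> 'a set set \<Rightarrow> 'b set \<Rightarrow> 'b set set \<Rightarrow> bool" where
  "induced_free V E W F \<longleftrightarrow> \<not> (\<exists>S\<subseteq>V. graph_iso S (induced_edges E S) W F)"

(* A drawing in the plane (identified with the complex numbers) without crossings: vertices are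
   distinct points, each edge is a simple arc joining its two ends, edges avoid all other
   vertices, and two different edges meet only in common end vertices. *)
definition plane_drawing ::
  "'a set \<Rightarrow> 'a set set \<Rightarrow> ('a \<Rightarrow> complex) \<Rightarrow> ('a set \<Rightarrow> real \<Rightarrow> complex) \<Rightarrow> bool" where
  "plane_drawing V E p \<gamma> \<longleftrightarrow>
     inj_on p V \<and>
     (\<forall>e\<in>E. arc (\<gamma> e) \<and> {pathstart (\<gamma> e), pathfinish (\<gamma> e)} = p ` e \<and>
            path_image (\<gamma> e) \<inter> p ` V = p ` e) \<and>
     (\<forall>e\<in>E. \<forall>e'\<in>E. e \<noteq> e' \<longrightarrow>
            path_image (\<gamma> e) \<inter> path_image (\<gamma> e') = p ` (e \<inter> e'))"

definition planar_graph :: "'a set \<Rightarrow> 'a set set \<Rightarrow> bool" where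
  "planar_graph V E \<longleftrightarrow> simple_graph V E \<and> (\<exists>p \<gamma>. plane_drawing V E p \<gamma>)"

(* The possible edge numbers do not depend on the type of the vertices, as every finite graph is
   isomorphic to one with vertices in nat. Max of the empty set is unspecified; the set is
   nonempty as soon as F has an edge, see planar_ind_edge_counts_nonempty. *)
definition planar_ind_edge_counts :: "nat \<Rightarrow> 'b set \<Rightarrow> 'b set set \<Rightarrow> nat set" where
  "planar_ind_edge_counts n W F =
     {card E | (V :: nat set) E. planar_graph V E \<and> card V = n \<and> induced_free V E W F}"

definition ex_planar_ind :: "nat \<Rightarrow> 'b set \<Rightarrow> 'b set set \<Rightarrow> nat" where
  "ex_planar_ind n W F = Max (planar_ind_edge_counts n W F)"

definition theta4_verts :: "nat set" where
  "theta4_verts = {0, 1, 2, 3}"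

definition theta4_edges :: "nat set set" where
  "theta4_edges = {{0, 1}, {1, 2}, {2, 3}, {3, 0}, {0, 2}}"

lemma simple_graph_theta4: "simple_graph theta4_verts theta4_edges"
  by (auto simp: simple_graph_def theta4_verts_def theta4_edges_def)

lemma finite_planar_ind_edge_counts: "finite (planar_ind_edge_counts n W F)"
proof (rule finite_subset)
  show "planar_ind_edge_counts n W F \<subseteq> {..2 ^ n}"
  proof
    fix m assume "m \<in> planar_ind_edge_counts n W F"
    then obtain V :: "nat set" and E where
      E: "m = card E" "finite V" "E \<subseteq> Pow V" "card V = n"
      by (auto simp: planar_ind_edge_counts_def planar_graph_def simple_graph_def)
    have "card E \<le> card (Pow V)"
      using E by (intro card_mono) auto
    then show "m \<in> {..2 ^ n}"
      using E by (simp add: card_Pow)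
  qed
qed simp

lemma planar_ind_edge_counts_nonempty:
  assumes "simple_graph W F" and "F \<noteq> {}"
  shows "planar_ind_edge_counts n W F \<noteq> {}"
proof -
  let ?p = "\<lambda>v::nat. complex_of_real (real v)"
  have "plane_drawing {..<n} {} ?p \<gamma>" for \<gamma>
    by (auto simp: plane_drawing_def inj_on_def)
  then have "planar_graph {..<n} ({} :: nat set set)"
    unfolding planar_graph_def simple_graph_def by blast
  moreover have "induced_free {..<n} {} W F"
  proof -
    from assms obtain e where "e \<in> F" "e \<subseteq> W" "card e = 2"
      by (auto simp: simple_graph_def)
    then obtain a b where ab: "{a, b} \<in> F" "a \<in> W" "b \<in> W"
      by (auto simp: card_2_iff)
    have no: False if bij: "bij_betw f S W"
      and *: "\<forall>u\<in>S. \<forall>v\<in>S. {u, v} \<in> {} \<longleftrightarrow> {f u, f v} \<in> F" for f and S :: "nat set"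
    proof -
      obtain u v where "u \<in> S" "v \<in> S" "f u = a" "f v = b"
        using ab bij_betw_imp_surj_on[OF bij] by blast
      then show False using * ab(1) by blast
    qed
    have "induced_edges {} S = {}" for S :: "nat set"
      by (simp add: induced_edges_def)
    with no show ?thesis
      unfolding induced_free_def graph_iso_def by metis
  qed
  moreover have "card {..<n} = n"
    by simp
  ultimately have "card ({} :: nat set set) \<in> planar_ind_edge_counts n W F"
    unfolding planar_ind_edge_counts_def by blast
  then show ?thesis by blast
qed

end

theory Submission
  imports Defs
begin

text \<open>
  Upper bound. A graph has no induced \<open>\<Theta>\<^sub>4\<close> iff any two triangles with a common edge span a
  \<open>K\<^sub>4\<close>. Delete bridges until every edge lies on a cycle; with \<open>c\<close> components and a family of \<open>f\<close> faces,
  Euler's inequality bounds the number of edges by \<open>n + f - 1 - c\<close>. Every edge then borders exactly two faces,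
  every face has at least three edges, and a face with exactly three edges is bounded by a triangle.
  If all three edges of a triangular face \<open>xyz\<close> were shared with triangular faces \<open>xya\<close>, \<open>yzb\<close>, \<open>zxc\<close>,
  then \<open>a = b = c\<close>: otherwise, say, \<open>a \<noteq> b\<close>, and the triangle \<open>yaz\<close> separates \<open>x\<close> from \<open>b\<close>
  although \<open>xb\<close> is an edge. So there are at most four faces in this case. In all other cases each
  triangular face owns an edge not shared with another one; double counting gives at most \<open>e / 2\<close> triangular faces,
  hence \<open>8 f \<le> 5 e\<close>, which is the bound.

  Sharpness. Stack a vertex into each of the eight triangles of the cuboctahedron (20 vertices, 48 edges),
  and glue \<open>k\<close> copies in parallel at two opposite vertices of a quadrilateral face. This gives
  \<open>18 k + 2\<close> vertices and \<open>48 k\<close> edges.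
\<close>


subsection \<open>Splitting a component by a Jordan curve\<close>

text \<open>Janiszewski's theorem: as \<open>J \<inter> K\<close> is connected, two points separated neither by \<open>J\<close> nor by
  \<open>K\<close> are not separated by \<open>J \<union> K\<close>.\<close>

lemma component_split_half:
  fixes K J S F :: "complex set"
  assumes "compact J" "closed K" and F: "F \<in> components (- K)" and S: "S \<in> components (- J)"
    and conn: "connected (J \<inter> K)" and fr: "z \<in> F" "z \<in> frontier S"
  shows "F \<inter> S \<in> components (- (K \<union> J))"
proof -
  have "open F"
    using assms open_components[of "- K" F] by auto
  then obtain a where a: "a \<in> F" "a \<in> S"
    using fr open_Int_closure_eq_empty[of F S] by (auto simp: frontier_def)
  have aX: "a \<in> - (K \<union> J)" using a F S in_components_subset by fastforce
  let ?C = "connected_component_set (- (K \<union> J)) a"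
  have C: "?C \<in> components (- (K \<union> J))" using aX by (rule componentsI)
  have "?C = F \<inter> S"
  proof
    have "?C \<subseteq> F"
      using F a aX by (intro components_maximal[of F "- K"])
        (use connected_component_subset[of "- (K \<union> J)" a] in auto)
    moreover have "?C \<subseteq> S"
      using S a aX by (intro components_maximal[of S "- J"])
        (use connected_component_subset[of "- (K \<union> J)" a] in auto)
    ultimately show "?C \<subseteq> F \<inter> S" by blast
    show "F \<inter> S \<subseteq> ?C"
    proof
      fix b assume b: "b \<in> F \<inter> S"
      have "connected_component (- J) a b"
        using b a S by (metis Int_iff components_iff connected_component_eq mem_Collect_eq)
      moreover have "connected_component (- K) a b"
        using b a F by (metis Int_iff components_iff connected_component_eq mem_Collect_eq)
      ultimately have "connected_component (- (J \<union> K)) a b"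
        using Janiszewski[of J K a b] assms by blast
      then show "b \<in> ?C" by (simp add: Un_commute)
    qed
  qed
  with C show ?thesis by simp
qed

lemma connected_path_image_endless:
  assumes "arc g"
  shows "connected (path_image g - {pathstart g, pathfinish g})"
  using connected_simple_path_endless[OF arc_imp_simple_path[OF assms]] .

text \<open>A continuous map sends the closure of an open interval into the closure of its image. So
  a closed set containing the interior of an edge also contains its ends.\<close>

lemma arc_endless_closure:
  assumes "arc g"
  shows "path_image g \<subseteq> closure (path_image g - {pathstart g, pathfinish g})"
proof -
  have g: "path g" "inj_on g {0..1}" using assms by (auto simp: arc_def)
  have "g ` {0<..<1} \<subseteq> path_image g - {pathstart g, pathfinish g}"
    using g(2) by (auto simp: path_image_def pathstart_def pathfinish_def inj_on_def)
      (metis atLeastAtMost_iff less_le less_le_not_le zero_le_one le_numeral_extra(3) order_refl)+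
  then have "closure (g ` {0<..<1}) \<subseteq> closure (path_image g - {pathstart g, pathfinish g})"
    by (rule closure_mono)
  moreover have "g ` closure {0<..<1} \<subseteq> closure (g ` {0<..<1})"
    using g(1) by (intro image_closure_subset)
      (auto simp: path_def intro: subsetD[OF closure_subset])
  ultimately show ?thesis by (auto simp: path_image_def)
qed

lemma arc_endless_nonempty:
  assumes "arc g"
  shows "path_image g - {pathstart g, pathfinish g} \<noteq> {}"
  using arc_endless_closure[OF assms] path_image_nonempty[of g] by fastforce

text \<open>Think of \<open>K\<close> as the skeleton before the edge \<open>g\<close> is drawn and
  of \<open>P\<close> as a way back inside \<open>K\<close>. The closed curve \<open>J\<close> meets
  \<open>K\<close> in the connected set \<open>path_image P\<close>, so
  \<open>component_split_half\<close> applies to both sides of \<open>J\<close>.\<close>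

lemma Jordan_split_component:
  fixes K :: "complex set"
  assumes K: "closed K" and g: "arc g" and P: "arc P"
    and ends: "pathstart P = pathfinish g" "pathfinish P = pathstart g"
    and PK: "path_image P \<subseteq> K" and gK: "path_image g \<inter> K = {pathstart g, pathfinish g}"
  defines "J \<equiv> path_image g \<union> path_image P"
  obtains F where "F \<in> components (- K)" "path_image g - {pathstart g, pathfinish g} \<subseteq> F"
    "F \<inter> inside J \<in> components (- (K \<union> path_image g))"
    "F \<inter> outside J \<in> components (- (K \<union> path_image g))"
    "path_image g \<subseteq> closure (F \<inter> inside J)" "path_image g \<subseteq> closure (F \<inter> outside J)"
proof -
  let ?i = "path_image g - {pathstart g, pathfinish g}"
  have sp: "simple_path (g +++ P)"
    using simple_path_join_loop_eq[of P g] ends g P PK gK by auto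
  have loop: "pathfinish (g +++ P) = pathstart (g +++ P)" using ends by simp
  have J: "path_image (g +++ P) = J" using ends by (simp add: path_image_join J_def)
  note jio = Jordan_inside_outside[OF sp loop, unfolded J]
  have cJ: "compact J"
    using g P by (auto simp: J_def arc_imp_path compact_path_image)
  obtain z where z: "z \<in> ?i" using arc_endless_nonempty[OF g] by blast
  define F where "F = connected_component_set (- K) z"
  have F: "F \<in> components (- K)"
    using z gK unfolding F_def by (intro componentsI) auto
  have iF: "?i \<subseteq> F"
    unfolding F_def using z gK by (intro connected_component_maximal connected_path_image_endless g) auto
  have oF: "open F" using F K open_components[of "- K"] by auto
  have JK: "J \<inter> K = path_image P"
    using PK gK ends pathstart_in_path_image[of P] pathfinish_in_path_image[of P] unfolding J_def
    by (simp add: Int_Un_distrib2 Int_absorb2 insert_absorb)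
  have conn: "connected (J \<inter> K)" unfolding JK using P by (simp add: arc_imp_path connected_path_image)
  have KJ: "K \<union> J = K \<union> path_image g" using PK by (auto simp: J_def)
  have in_comp: "inside J \<in> components (- J)" "outside J \<in> components (- J)"
  proof -
    show "inside J \<in> components (- J)"
      using jio inside_in_components by blast
    show "outside J \<in> components (- J)"
      using jio outside_in_components by blast
  qed
  have sub: "path_image g \<subseteq> closure (F \<inter> S)" if "frontier S = J" "open S" for S
  proof -
    have "?i \<subseteq> closure (F \<inter> S)"
    proof
      fix x assume x: "x \<in> ?i"
      then have "x \<in> closure S" using that by (auto simp: frontier_def J_def)
      then show "x \<in> closure (F \<inter> S)"
        using open_Int_closure_subset[OF oF, of S] x iF by blast
    qed
    then show ?thesis
      using arc_endless_closure[OF g] closure_minimal[OF _ closed_closure] by blast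
  qed
  have zJ: "z \<in> J" using z by (auto simp: J_def)
  show ?thesis
  proof (rule that[OF F iF])
    show "F \<inter> inside J \<in> components (- (K \<union> path_image g))"
      using component_split_half[OF cJ K F in_comp(1) conn, of z] jio iF z zJ KJ by auto
    show "F \<inter> outside J \<in> components (- (K \<union> path_image g))"
      using component_split_half[OF cJ K F in_comp(2) conn, of z] jio iF z zJ KJ by auto
    show "path_image g \<subseteq> closure (F \<inter> inside J)" "path_image g \<subseteq> closure (F \<inter> outside J)"
      using sub jio by auto
  qed
qed

text \<open>Relative to the connected set \<open>- T\<close>, the set \<open>A\<close> is both open
  and closed.\<close>

lemma clopen_in_complement:
  fixes A T :: "'a::topological_space set"
  assumes "open A" "A \<noteq> {}" "A \<inter> T = {}" "connected (- T)" "closure A \<subseteq> A \<union> T"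
  shows "A = - T"
proof -
  have "A \<inter> - T = {} \<or> - closure A \<inter> - T = {}"
    using assms closure_subset[of A] by (intro connectedD[of "- T" A "- closure A"]) auto
  then show ?thesis using assms by auto
qed

subsection \<open>Faces of a plane graph\<close>

definition skeleton :: "('a \<Rightarrow> complex) \<Rightarrow> ('a set \<Rightarrow> real \<Rightarrow> complex) \<Rightarrow> 'a set \<Rightarrow> 'a set set \<Rightarrow> complex set" where
  "skeleton p \<gamma> V E = p ` V \<union> (\<Union>e\<in>E. path_image (\<gamma> e))"

definition faces :: "('a \<Rightarrow> complex) \<Rightarrow> ('a set \<Rightarrow> real \<Rightarrow> complex) \<Rightarrow> 'a set \<Rightarrow> 'a set set \<Rightarrow> complex set set" where
  "faces p \<gamma> V E = components (- skeleton p \<gamma> V E)"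

text \<open>The ends of the arc are left out: a face touching \<open>e\<close> only in an end vertex
  does not lie along \<open>e\<close>.\<close>

definition edge_faces :: "('a \<Rightarrow> complex) \<Rightarrow> ('a set \<Rightarrow> real \<Rightarrow> complex) \<Rightarrow> 'a set \<Rightarrow> 'a set set \<Rightarrow> 'a set \<Rightarrow> complex set set" where
  "edge_faces p \<gamma> V E e = {A \<in> faces p \<gamma> V E. closure A \<inter> (path_image (\<gamma> e) - p ` e) \<noteq> {}}"

definition face_edges :: "('a \<Rightarrow> complex) \<Rightarrow> ('a set \<Rightarrow> real \<Rightarrow> complex) \<Rightarrow> 'a set \<Rightarrow> 'a set set \<Rightarrow> complex set \<Rightarrow> 'a set set" where
  "face_edges p \<gamma> V E A = {e \<in> E. A \<in> edge_faces p \<gamma> V E e}"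

definition linked :: "'a set set \<Rightarrow> 'a \<Rightarrow> 'a \<Rightarrow> bool" where
  "linked E = (\<lambda>u v. {u, v} \<in> E)\<^sup>*\<^sup>*"

definition bridgeless :: "'a set set \<Rightarrow> bool" where
  "bridgeless E \<longleftrightarrow> (\<forall>u v. {u, v} \<in> E \<longrightarrow> linked (E - {{u, v}}) u v)"

locale plane_graph =
  fixes V :: "'a set" and E :: "'a set set" and p :: "'a \<Rightarrow> complex"
    and \<gamma> :: "'a set \<Rightarrow> real \<Rightarrow> complex"
  assumes simple: "simple_graph V E" and drawing: "plane_drawing V E p \<gamma>"
begin

lemma finite_V [simp]: "finite V" using simple by (simp add: simple_graph_def)

lemma edge_subset: "e \<in> E \<Longrightarrow> e \<subseteq> V" using simple by (simp add: simple_graph_def)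

lemma edge_card: "e \<in> E \<Longrightarrow> card e = 2" using simple by (simp add: simple_graph_def)

lemma edgeE:
  assumes "e \<in> E"
  obtains u v where "e = {u, v}" "u \<noteq> v" "u \<in> V" "v \<in> V"
  using edge_card[OF assms] edge_subset[OF assms] by (auto simp: card_2_iff)

lemma edge_distinct: "{u, v} \<in> E \<Longrightarrow> u \<noteq> v"
  using edge_card[of "{u, v}"] by auto

lemma edge_verts: "{u, v} \<in> E \<Longrightarrow> u \<in> V \<and> v \<in> V"
  using edge_subset[of "{u, v}"] by auto

lemma finite_E [simp]: "finite E"
  using finite_subset[of E "Pow V"] edge_subset by auto

lemma subgraph: "E' \<subseteq> E \<Longrightarrow> plane_graph V E' p \<gamma>"
  using simple drawing unfolding plane_graph_def simple_graph_def plane_drawing_def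
  by (meson subsetD)

lemma inj_p: "inj_on p V" using drawing by (simp add: plane_drawing_def)

lemma arc_edge: "e \<in> E \<Longrightarrow> arc (\<gamma> e)" using drawing by (simp add: plane_drawing_def)

lemma edge_ends: "e \<in> E \<Longrightarrow> {pathstart (\<gamma> e), pathfinish (\<gamma> e)} = p ` e"
  using drawing by (simp add: plane_drawing_def)

lemma edge_Int_verts: "e \<in> E \<Longrightarrow> path_image (\<gamma> e) \<inter> p ` V = p ` e"
  using drawing by (simp add: plane_drawing_def)

lemma edge_Int: "e \<in> E \<Longrightarrow> e' \<in> E \<Longrightarrow> e \<noteq> e' \<Longrightarrow>
    path_image (\<gamma> e) \<inter> path_image (\<gamma> e') = p ` (e \<inter> e')"
  using drawing by (simp add: plane_drawing_def)

lemma edge_Int_skeleton: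
  assumes "e \<in> E"
  shows "path_image (\<gamma> e) \<inter> skeleton p \<gamma> V (E - {e}) = p ` e"
  using edge_Int_verts[OF assms] edge_Int[OF assms] unfolding skeleton_def by blast

lemma skeleton_insert:
  "e \<in> E \<Longrightarrow> skeleton p \<gamma> V E = skeleton p \<gamma> V (E - {e}) \<union> path_image (\<gamma> e)"
  unfolding skeleton_def by blast

lemma compact_skeleton: "compact (skeleton p \<gamma> V E)"
  unfolding skeleton_def
  by (intro compact_Un finite_imp_compact finite_imageI compact_UN ballI compact_path_image arc_imp_path arc_edge)
    auto

lemma closed_skeleton: "closed (skeleton p \<gamma> V E)"
  using compact_skeleton by (rule compact_imp_closed)

lemma open_face: "A \<in> faces p \<gamma> V E \<Longrightarrow> open A"
  using closed_skeleton open_components[of "- skeleton p \<gamma> V E"] by (auto simp: faces_def)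

lemma face_nonempty: "A \<in> faces p \<gamma> V E \<Longrightarrow> A \<noteq> {}"
  using in_components_nonempty by (auto simp: faces_def)

lemma face_Int_skeleton: "A \<in> faces p \<gamma> V E \<Longrightarrow> A \<inter> skeleton p \<gamma> V E = {}"
  using in_components_subset[of A] by (auto simp: faces_def)

lemma faces_disjoint: "A \<in> faces p \<gamma> V E \<Longrightarrow> B \<in> faces p \<gamma> V E \<Longrightarrow> x \<in> A \<Longrightarrow> x \<in> B \<Longrightarrow> A = B"
  using components_nonoverlap[of A _ B] by (auto simp: faces_def)

lemma face_closure_subset:
  assumes "A \<in> faces p \<gamma> V E"
  shows "closure A \<subseteq> A \<union> skeleton p \<gamma> V E"
proof
  fix x assume x: "x \<in> closure A"
  show "x \<in> A \<union> skeleton p \<gamma> V E"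
  proof (cases "x \<in> skeleton p \<gamma> V E")
    case False
    let ?B = "connected_component_set (- skeleton p \<gamma> V E) x"
    have B: "?B \<in> faces p \<gamma> V E" unfolding faces_def using False by (intro componentsI) auto
    have "x \<in> ?B" using False by simp
    then have "?B \<inter> A \<noteq> {}"
      using x open_Int_closure_eq_empty[OF open_face[OF B], of A] by (metis IntI emptyE)
    then have "?B = A" using faces_disjoint[OF B assms] by blast
    with \<open>x \<in> ?B\<close> show ?thesis by blast
  qed auto
qed

text \<open>\<open>plane_drawing\<close> fixes only the set of ends of an arc, so the arc may run
  from \<open>v\<close> to \<open>u\<close> and then has to be reversed.\<close>

lemma edge_arc:
  assumes "{u, v} \<in> E"
  obtains g where "arc g" "pathstart g = p u" "pathfinish g = p v"
    "path_image g = path_image (\<gamma> {u, v})"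
proof -
  have uv: "p u \<noteq> p v"
    using inj_p edge_verts[OF assms] edge_distinct[OF assms] by (auto dest: inj_onD)
  have "{pathstart (\<gamma> {u, v}), pathfinish (\<gamma> {u, v})} = {p u, p v}"
    using edge_ends[OF assms] by simp
  then consider "pathstart (\<gamma> {u, v}) = p u" "pathfinish (\<gamma> {u, v}) = p v"
    | "pathstart (\<gamma> {u, v}) = p v" "pathfinish (\<gamma> {u, v}) = p u"
    using uv by (auto simp: doubleton_eq_iff)
  then show ?thesis
  proof cases
    case 1
    then show ?thesis using that arc_edge[OF assms] by blast
  next
    case 2
    then show ?thesis
      using that[of "reversepath (\<gamma> {u, v})"] arc_reversepath[OF arc_edge[OF assms]] by simp
  qed
qed

lemma linked_path_component:
  assumes "linked E u v" "u \<in> V"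
  shows "path_component (skeleton p \<gamma> V E) (p u) (p v)"
  using assms(1) unfolding linked_def
proof (induction rule: rtranclp_induct)
  case base
  show ?case using assms(2) by (intro path_component_refl) (auto simp: skeleton_def)
next
  case (step y z)
  obtain g where g: "arc g" "pathstart g = p y" "pathfinish g = p z"
    "path_image g = path_image (\<gamma> {y, z})"
    using edge_arc[OF step.hyps(2)] by blast
  have "path_component (skeleton p \<gamma> V E) (p y) (p z)"
    unfolding path_component_def
    using g step.hyps(2) by (intro exI[of _ g]) (auto simp: skeleton_def arc_imp_path)
  with step.IH show ?case by (rule path_component_trans)
qed

text \<open>The rest of a cycle through \<open>uv\<close>, as the arc \<open>P\<close> that
  \<open>Jordan_split_component\<close> asks for: the remaining edges give a path, and a path
  between distinct points contains an arc.\<close>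

lemma return_arc:
  assumes e: "{u, v} \<in> E" and "linked (E - {{u, v}}) u v"
  obtains P where "arc P" "pathstart P = p v" "pathfinish P = p u"
    "path_image P \<subseteq> skeleton p \<gamma> V (E - {{u, v}})"
proof -
  interpret D: plane_graph V "E - {{u, v}}" p \<gamma> by (rule subgraph) blast
  have uv: "p u \<noteq> p v"
    using inj_p edge_verts[OF e] edge_distinct[OF e] by (auto dest: inj_onD)
  have "path_component (skeleton p \<gamma> V (E - {{u, v}})) (p v) (p u)"
    using D.linked_path_component[OF assms(2)] edge_verts[OF e] path_component_sym by blast
  then obtain h where "path h" "path_image h \<subseteq> skeleton p \<gamma> V (E - {{u, v}})"
    "pathstart h = p v" "pathfinish h = p u"
    by (auto simp: path_component_def)
  then obtain P where "arc P" "path_image P \<subseteq> path_image h" "pathstart P = p v" "pathfinish P = p u"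
    using path_contains_arc[of h "p v" "p u"] uv by metis
  then show ?thesis using that \<open>path_image h \<subseteq> _\<close> by blast
qed

text \<open>\<open>Jordan_split_component\<close> yields two faces along the edge. There is no
  third: the face \<open>F\<close> of the graph without the edge is an open set around its interior,
  so every face along the edge meets \<open>F\<close>, and \<open>F\<close> is covered by
  \<open>A\<close>, \<open>B\<close> and that interior.\<close>

lemma edge_sides:
  assumes e: "{u, v} \<in> E" and P: "arc P" "pathstart P = p v" "pathfinish P = p u"
    "path_image P \<subseteq> skeleton p \<gamma> V (E - {{u, v}})"
  obtains A B F where "edge_faces p \<gamma> V E {u, v} = {A, B}" "A \<noteq> B"
    "A \<in> faces p \<gamma> V E" "B \<in> faces p \<gamma> V E"
    "A \<subseteq> inside (path_image (\<gamma> {u, v}) \<union> path_image P)"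
    "B \<subseteq> outside (path_image (\<gamma> {u, v}) \<union> path_image P)"
    "path_image (\<gamma> {u, v}) \<subseteq> closure A" "path_image (\<gamma> {u, v}) \<subseteq> closure B"
    "open F" "F \<in> faces p \<gamma> V (E - {{u, v}})" "A \<subseteq> F" "B \<subseteq> F"
    "path_image (\<gamma> {u, v}) - p ` {u, v} \<subseteq> F"
    "F \<subseteq> A \<union> B \<union> (path_image (\<gamma> {u, v}) - p ` {u, v})"
proof -
  interpret D: plane_graph V "E - {{u, v}}" p \<gamma> by (rule subgraph) blast
  let ?K = "skeleton p \<gamma> V (E - {{u, v}})"
  obtain g where g: "arc g" "pathstart g = p u" "pathfinish g = p v"
    "path_image g = path_image (\<gamma> {u, v})"
    using edge_arc[OF e] by blast
  let ?J = "path_image g \<union> path_image P" and ?i = "path_image g - p ` {u, v}"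
  have gK: "path_image g \<inter> ?K = {pathstart g, pathfinish g}"
    using edge_Int_skeleton[OF e] g by simp
  obtain F where F: "F \<in> components (- ?K)" "?i \<subseteq> F"
    "F \<inter> inside ?J \<in> components (- (?K \<union> path_image g))"
    "F \<inter> outside ?J \<in> components (- (?K \<union> path_image g))"
    "path_image g \<subseteq> closure (F \<inter> inside ?J)" "path_image g \<subseteq> closure (F \<inter> outside ?J)"
  proof (rule Jordan_split_component[OF D.closed_skeleton g(1) P(1) _ _ P(4) gK], goal_cases)
    case (3 F)
    then show ?case by (intro that[of F]) (use g in auto)
  qed (use P g in auto)
  let ?A = "F \<inter> inside ?J" and ?B = "F \<inter> outside ?J"
  have fc: "?A \<in> faces p \<gamma> V E" "?B \<in> faces p \<gamma> V E"
    using F(3,4) skeleton_insert[OF e] g(4) by (simp_all add: faces_def)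
  have oF: "open F" using D.open_face F(1) by (simp add: faces_def)
  have FK: "F \<inter> ?K = {}" using D.face_Int_skeleton F(1) by (simp add: faces_def)
  have cover: "F \<subseteq> ?A \<union> ?B \<union> ?i"
  proof
    fix x assume x: "x \<in> F"
    have "x \<in> inside ?J \<or> x \<in> outside ?J \<or> x \<in> ?J"
      using inside_Un_outside[of ?J] by blast
    moreover have "x \<notin> path_image P" using x FK P(4) by blast
    moreover have "x \<notin> p ` {u, v}" using x FK gK g by auto
    ultimately show "x \<in> ?A \<union> ?B \<union> ?i" using x by blast
  qed
  have ine: "?i \<noteq> {}" using arc_endless_nonempty[OF g(1)] g by simp
  have "edge_faces p \<gamma> V E {u, v} = {?A, ?B}"
  proof
    show "{?A, ?B} \<subseteq> edge_faces p \<gamma> V E {u, v}"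
      using fc F(5,6) ine g(4) unfolding edge_faces_def by blast
    show "edge_faces p \<gamma> V E {u, v} \<subseteq> {?A, ?B}"
    proof
      fix C assume "C \<in> edge_faces p \<gamma> V E {u, v}"
      then have C: "C \<in> faces p \<gamma> V E" "closure C \<inter> ?i \<noteq> {}"
        using g by (auto simp: edge_faces_def)
      then have "F \<inter> C \<noteq> {}" using F(2) open_Int_closure_eq_empty[OF oF, of C] by auto
      then obtain x where x: "x \<in> F" "x \<in> C" by blast
      moreover have "x \<notin> ?i"
        using x face_Int_skeleton[OF C(1)] skeleton_insert[OF e] g(4) by auto
      ultimately have "x \<in> ?A \<or> x \<in> ?B" using cover by blast
      then show "C \<in> {?A, ?B}" using x faces_disjoint[OF C(1)] fc by blast
    qed
  qed
  moreover have "?A \<noteq> ?B"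
    using face_nonempty[OF fc(1)] inside_Int_outside[of ?J] by blast
  moreover have "F \<in> faces p \<gamma> V (E - {{u, v}})" using F(1) by (simp add: faces_def)
  ultimately show ?thesis
    by (intro that[of ?A ?B F]) (use fc F oF cover g(4) in \<open>simp_all\<close>)
qed

end

subsection \<open>Euler's inequality\<close>

lemma linked_refl [simp]: "linked E u u" by (simp add: linked_def)

lemma linked_edge: "{u, v} \<in> E \<Longrightarrow> linked E u v" by (auto simp: linked_def)

lemma linked_trans: "linked E u v \<Longrightarrow> linked E v w \<Longrightarrow> linked E u w"
  unfolding linked_def by (rule rtranclp_trans)

lemma linked_sym: "linked E u v \<Longrightarrow> linked E v u"
  unfolding linked_def
  by (rule sympD[OF symp_rtranclp]) (auto simp: symp_def insert_commute)

lemma linked_mono: "E' \<subseteq> E \<Longrightarrow> linked E' u v \<Longrightarrow> linked E u v"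
  unfolding linked_def by (erule rtranclp_mono[THEN predicate2D, rotated]) auto

text \<open>These are the vertex sets of the connected components; an isolated vertex forms a class
  of its own.\<close>

definition link_classes :: "'a set \<Rightarrow> 'a set set \<Rightarrow> 'a set set" where
  "link_classes V E = (\<lambda>u. {v \<in> V. linked E u v}) ` V"

lemma link_classes_coarsen:
  fixes V :: "'a set" and E E' :: "'a set set"
  assumes "E' \<subseteq> E"
  defines "h \<equiv> \<lambda>C. \<Union>u\<in>C. {v \<in> V. linked E u v}"
  shows "\<And>u. u \<in> V \<Longrightarrow> h {v \<in> V. linked E' u v} = {v \<in> V. linked E u v}"
    and "link_classes V E = h ` link_classes V E'"
proof -
  show *: "h {v \<in> V. linked E' u v} = {v \<in> V. linked E u v}" if "u \<in> V" for u
    using that linked_mono[OF assms(1)] unfolding h_def by (auto intro: linked_trans)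
  show "link_classes V E = h ` link_classes V E'"
    unfolding link_classes_def image_image by (rule image_cong) (simp_all add: *)
qed

lemma card_link_classes_antimono:
  assumes "finite V" "E' \<subseteq> E"
  shows "card (link_classes V E) \<le> card (link_classes V E')"
  using link_classes_coarsen(2)[OF assms(2), where V = V] assms(1)
  by (simp add: link_classes_def card_image_le)

text \<open>The coarsening map \<open>h\<close> sends the different classes of \<open>u\<close> and
  \<open>v\<close> to the same class, so it is not injective and the number of classes
  drops.\<close>

lemma card_link_classes_bridge:
  assumes "finite V" "{u, v} \<in> E" "u \<in> V" "v \<in> V" "\<not> linked (E - {{u, v}}) u v"
  shows "card (link_classes V E) < card (link_classes V (E - {{u, v}}))"
proof -
  let ?E = "E - {{u, v}}"
  let ?h = "\<lambda>C. \<Union>u\<in>C. {v \<in> V. linked E u v}"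
  have sub: "?E \<subseteq> E" by blast
  note h = link_classes_coarsen[OF sub, where V = V]
  have "?h {w \<in> V. linked ?E u w} = ?h {w \<in> V. linked ?E v w}"
    unfolding h(1)[OF assms(3)] h(1)[OF assms(4)]
    using linked_edge[OF assms(2)] linked_trans[of E] linked_sym[of E u v] by blast
  moreover have "v \<in> {w \<in> V. linked ?E v w}" "v \<notin> {w \<in> V. linked ?E u w}"
    using assms(4,5) by auto
  then have "{w \<in> V. linked ?E u w} \<noteq> {w \<in> V. linked ?E v w}" by blast
  ultimately have "\<not> inj_on ?h (link_classes V ?E)"
    using assms(3,4) unfolding link_classes_def by (auto dest!: inj_onD[where x = "{w \<in> V. linked ?E u w}" and y = "{w \<in> V. linked ?E v w}"])
  moreover have fin: "finite (link_classes V ?E)" using assms(1) by (simp add: link_classes_def)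
  ultimately have "card (?h ` link_classes V ?E) < card (link_classes V ?E)"
    using eq_card_imp_inj_on card_image_le le_neq_implies_less by blast
  then show ?thesis using link_classes_coarsen(2)[OF sub, where V = V] by simp
qed

lemma card_link_classes_pos:
  assumes "finite V" "V \<noteq> {}" shows "0 < card (link_classes V E)"
  using assms by (simp add: link_classes_def card_gt_0_iff)

lemma connected_Compl_finite:
  fixes S :: "complex set"
  assumes "finite S" shows "connected (- S)"
  unfolding Compl_eq_Diff_UNIV
  by (rule connected_open_diff_countable) (simp_all add: assms countable_finite convex_connected)

context plane_graph
begin

text \<open>Used for bridges, where \<open>F\<close> must leave room for a face once the arc is
  drawn. If \<open>F\<close> lay inside the arc, it would be open and closed in the plane minus the
  two ends, so the arc would fill the plane, which a compact set cannot.\<close>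

lemma edge_face_extends:
  assumes e: "e \<in> E"
  obtains F where "F \<in> faces p \<gamma> V (E - {e})" "path_image (\<gamma> e) - p ` e \<subseteq> F"
    "\<not> F \<subseteq> path_image (\<gamma> e)"
proof -
  interpret D: plane_graph V "E - {e}" p \<gamma> by (rule subgraph) blast
  let ?g = "\<gamma> e" and ?K = "skeleton p \<gamma> V (E - {e})"
  have g: "arc ?g" "{pathstart ?g, pathfinish ?g} = p ` e" using arc_edge edge_ends e by auto
  have i: "connected (path_image ?g - p ` e)" "path_image ?g - p ` e \<noteq> {}"
    using connected_path_image_endless[OF g(1)] arc_endless_nonempty[OF g(1)] g(2) by auto
  moreover have sub: "path_image ?g - p ` e \<subseteq> - ?K" using edge_Int_skeleton[OF e] by blast
  ultimately obtain F where F: "F \<in> components (- ?K)" "path_image ?g - p ` e \<subseteq> F"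
    using exists_component_superset[of "path_image ?g - p ` e" "- ?K"] by blast
  have "\<not> F \<subseteq> path_image ?g"
  proof
    assume F': "F \<subseteq> path_image ?g"
    have face: "F \<in> faces p \<gamma> V (E - {e})" using F by (simp add: faces_def)
    have dis: "F \<inter> p ` e = {}"
      using D.face_Int_skeleton[OF face] edge_subset[OF e] unfolding skeleton_def by blast
    have fin: "finite (p ` e)" using edge_subset[OF e] finite_V finite_subset by blast
    have "closure F \<subseteq> F \<union> p ` e"
      using closure_minimal[OF F' closed_path_image[OF arc_imp_path[OF g(1)]]] F(2) by blast
    moreover have "connected (- (p ` e))" using fin by (rule connected_Compl_finite)
    ultimately have "F = - (p ` e)"
      using clopen_in_complement[OF D.open_face[OF face] D.face_nonempty[OF face] dis] by blast
    moreover have "p ` e \<subseteq> path_image ?g" using edge_Int_verts[OF e] by blast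
    ultimately have "path_image ?g = UNIV" using F' by blast
    then show False using compact_path_image[OF arc_imp_path[OF g(1)]] not_compact_UNIV by metis
  qed
  with F that show ?thesis by (simp add: faces_def)
qed

text \<open>\<open>H\<close> misses the vertices and also \<open>F\<close>, which contains the
  interior of the arc; drawing the edge therefore leaves \<open>H\<close> untouched.\<close>

lemma faces_avoiding_edge:
  assumes e: "e \<in> E" and F: "F \<in> faces p \<gamma> V (E - {e})" "path_image (\<gamma> e) - p ` e \<subseteq> F"
    and H: "H \<in> faces p \<gamma> V (E - {e})" "H \<noteq> F"
  shows "H \<in> faces p \<gamma> V E"
proof -
  interpret D: plane_graph V "E - {e}" p \<gamma> by (rule subgraph) blast
  have "H \<inter> F = {}" using D.faces_disjoint F(1) H by blast
  moreover have "H \<inter> p ` e = {}"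
    using D.face_Int_skeleton[OF H(1)] edge_subset[OF e] unfolding skeleton_def by blast
  ultimately have "H \<inter> path_image (\<gamma> e) = {}" using F(2) by blast
  then have "H \<subseteq> - skeleton p \<gamma> V E"
    using D.face_Int_skeleton[OF H(1)] skeleton_insert[OF e] by blast
  then show ?thesis
    using components_intermediate_subset[of H "- skeleton p \<gamma> V (E - {e})" "- skeleton p \<gamma> V E"]
      H(1) skeleton_insert[OF e] unfolding faces_def by blast
qed

end

text \<open>Induction on the number of edges. An edge that closes a cycle splits a face in two and
  does not raise the number of classes; a bridge may gain no face but lowers the number of
  classes.\<close>

lemma Euler_inequality:
  assumes "plane_graph V E p \<gamma>"
  shows "\<exists>\<F>. finite \<F> \<and> \<F> \<subseteq> faces p \<gamma> V E \<and>
    card E + card (link_classes V E) + 1 \<le> card V + card \<F>"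
  using assms
proof (induction "card E" arbitrary: E)
  case 0
  interpret plane_graph V E p \<gamma> by (rule 0(2))
  have E: "E = {}" using 0(1)[symmetric] by simp
  have "finite (skeleton p \<gamma> V E)" using E by (simp add: skeleton_def)
  then have "- skeleton p \<gamma> V E \<noteq> {}"
    using infinite_UNIV_char_0[where 'a = complex] by (metis Compl_empty_eq double_complement)
  then obtain A where "A \<in> faces p \<gamma> V E"
    unfolding faces_def using components_eq_empty by blast
  moreover have "card (link_classes V E) \<le> card V" by (simp add: link_classes_def card_image_le)
  ultimately show ?case using E by (intro exI[of _ "{A}"]) auto
next
  case (Suc n)
  interpret plane_graph V E p \<gamma> by (rule Suc.prems)
  have "E \<noteq> {}" using Suc.hyps(2) by auto
  then obtain e where "e \<in> E" by blast
  moreover from this obtain u v where "e = {u, v}" by (rule edgeE)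
  ultimately have e: "{u, v} \<in> E" by simp
  let ?e = "{u, v}"
  interpret D: plane_graph V "E - {?e}" p \<gamma> by (rule subgraph) blast
  have cE: "card E = Suc (card (E - {?e}))" by (rule card.remove[OF finite_E e])
  then obtain \<F> where \<F>: "finite \<F>" "\<F> \<subseteq> faces p \<gamma> V (E - {?e})"
    "card (E - {?e}) + card (link_classes V (E - {?e})) + 1 \<le> card V + card \<F>"
    using Suc.hyps(1)[OF _ D.plane_graph_axioms] Suc.hyps(2) by (metis Suc_inject)
  show ?case
  proof (cases "linked (E - {?e}) u v")
    case True
    obtain P where P: "arc P" "pathstart P = p v" "pathfinish P = p u"
      "path_image P \<subseteq> skeleton p \<gamma> V (E - {?e})"
      using return_arc[OF e True] by blast
    obtain A B F where AB: "A \<noteq> B" "A \<in> faces p \<gamma> V E" "B \<in> faces p \<gamma> V E"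
      "F \<in> faces p \<gamma> V (E - {?e})" "A \<subseteq> F" "B \<subseteq> F" "path_image (\<gamma> ?e) - p ` ?e \<subseteq> F"
      by (rule edge_sides[OF e P])
    \<comment> \<open>\<open>F\<close> may be missing from \<open>\<F>\<close>. Taking it out costs
      at most one face, and \<open>A\<close> and \<open>B\<close>, both inside \<open>F\<close>, are
      new, so the family grows by at least one.\<close>
    let ?G = "insert A (insert B (\<F> - {F}))"
    have nin: "C \<notin> \<F> - {F}" if "C \<in> {A, B}" for C
    proof
      assume "C \<in> \<F> - {F}"
      moreover have "C \<subseteq> F" "C \<noteq> {}" using that AB face_nonempty by auto
      ultimately show False using D.faces_disjoint[of C F] \<F>(2) AB(4) by blast
    qed
    have "?G \<subseteq> faces p \<gamma> V E"
      using AB faces_avoiding_edge[OF e AB(4,7)] \<F>(2) by blast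
    moreover have "card ?G = card (\<F> - {F}) + 2" using nin AB(1) \<F>(1) by simp
    moreover have "card \<F> \<le> card (\<F> - {F}) + 1" using diff_card_le_card_Diff[of "{F}" \<F>]
      by (simp add: card_Diff_singleton_if)
    moreover have "card (link_classes V E) \<le> card (link_classes V (E - {?e}))"
      by (rule card_link_classes_antimono) auto
    ultimately show ?thesis using \<F> cE by (intro exI[of _ ?G]) auto
  next
    case False
    obtain F where F: "F \<in> faces p \<gamma> V (E - {?e})" "path_image (\<gamma> ?e) - p ` ?e \<subseteq> F"
      "\<not> F \<subseteq> path_image (\<gamma> ?e)"
      using edge_face_extends[OF e] by blast
    then obtain x where x: "x \<in> F" "x \<notin> path_image (\<gamma> ?e)" by blast
    have xX: "x \<in> - skeleton p \<gamma> V E"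
      using x D.face_Int_skeleton[OF F(1)] skeleton_insert[OF e] by blast
    let ?C = "connected_component_set (- skeleton p \<gamma> V E) x"
    have C: "?C \<in> faces p \<gamma> V E" unfolding faces_def using xX by (rule componentsI)
    \<comment> \<open>The face through the left-over point \<open>x\<close> replaces
      \<open>F\<close>; the new edge is paid for by the drop in the number of classes.\<close>
    let ?G = "insert ?C (\<F> - {F})"
    have xC: "x \<in> ?C" using xX by simp
    have "?C \<notin> \<F> - {F}" using D.faces_disjoint[of _ F x] \<F>(2) F(1) x(1) xC by blast
    then have "card ?G = card (\<F> - {F}) + 1" using \<F>(1) by simp
    moreover have "?G \<subseteq> faces p \<gamma> V E"
      using C faces_avoiding_edge[OF e F(1,2)] \<F>(2) by blast
    moreover have "card \<F> \<le> card (\<F> - {F}) + 1" using diff_card_le_card_Diff[of "{F}" \<F>]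
      by (simp add: card_Diff_singleton_if)
    moreover have "card (link_classes V E) < card (link_classes V (E - {?e}))"
      using edge_verts[OF e] False by (intro card_link_classes_bridge e finite_V) auto
    ultimately show ?thesis using \<F> cE by (intro exI[of _ ?G]) auto
  qed
qed

text \<open>The absence of an induced \<open>\<Theta>\<^sub>4\<close>, see \<open>induced_free_theta4_iff\<close>; in this form it survives the deletion of
  bridges.\<close>

definition theta_closed :: "'a set set \<Rightarrow> bool" where
  "theta_closed E \<longleftrightarrow> (\<forall>x y z a. {x, y} \<in> E \<longrightarrow> {y, z} \<in> E \<longrightarrow> {z, x} \<in> E \<longrightarrow>
     {x, a} \<in> E \<longrightarrow> {y, a} \<in> E \<longrightarrow> a \<noteq> z \<longrightarrow> {z, a} \<in> E)"

text \<open>Deleting a bridge costs one edge and gains at least one class, so the sum of the two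
  numbers, which \<open>Euler_inequality\<close> bounds, never falls.\<close>

lemma bridgeless_subgraph:
  assumes "simple_graph V E" "theta_closed E"
  shows "\<exists>E'\<subseteq>E. bridgeless E' \<and> theta_closed E' \<and>
    card E + card (link_classes V E) \<le> card E' + card (link_classes V E')"
  using assms
proof (induction "card E" arbitrary: E rule: less_induct)
  case less
  have fin: "finite V" "finite E"
    using less.prems(1) finite_subset[of E "Pow V"] by (auto simp: simple_graph_def)
  show ?case
  proof (cases "bridgeless E")
    case False
    then obtain u v where e: "{u, v} \<in> E" and nl: "\<not> linked (E - {{u, v}}) u v"
      by (auto simp: bridgeless_def)
    let ?E = "E - {{u, v}}"
    have cE: "card E = Suc (card ?E)" by (rule card.remove[OF fin(2) e])
    have s: "simple_graph V ?E" using less.prems(1) by (auto simp: simple_graph_def)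
    have "theta_closed ?E"
      unfolding theta_closed_def
    proof (intro allI impI)
      fix x y z a
      assume *: "{x, y} \<in> ?E" "{y, z} \<in> ?E" "{z, x} \<in> ?E" "{x, a} \<in> ?E" "{y, a} \<in> ?E" "a \<noteq> z"
      then have "{z, a} \<in> E" using less.prems(2) unfolding theta_closed_def by blast
      \<comment> \<open>The path through \<open>x\<close> still joins \<open>z\<close> and
        \<open>a\<close>, so \<open>za\<close> is not the deleted bridge.\<close>
      moreover have "linked ?E z a"
        by (rule linked_trans[OF linked_edge[OF *(3)] linked_edge[OF *(4)]])
      then have "{z, a} \<noteq> {u, v}" using nl linked_sym[of ?E z a] by (auto simp: doubleton_eq_iff)
      ultimately show "{z, a} \<in> ?E" by blast
    qed
    then obtain E' where "E' \<subseteq> ?E" "bridgeless E'" "theta_closed E'"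
      "card ?E + card (link_classes V ?E) \<le> card E' + card (link_classes V E')"
      using less.hyps[of ?E] cE s by auto
    moreover have "card (link_classes V E) < card (link_classes V ?E)"
      using less.prems(1) e nl fin by (intro card_link_classes_bridge) (auto simp: simple_graph_def)
    ultimately show ?thesis using cE by (intro exI[of _ E']) auto
  qed (use less.prems in blast)
qed

subsection \<open>Faces with few edges\<close>

lemma card_triangle:
  assumes "x \<noteq> y" "y \<noteq> z" "z \<noteq> x"
  shows "card {{x, y}, {y, z}, {z, x}} = 3"
  using assms by (simp add: doubleton_eq_iff)

lemma triangle_containing:
  assumes "s \<noteq> t" "t \<noteq> r" "r \<noteq> s" "{x, y} \<in> {{s, t}, {t, r}, {r, s}}"
  obtains a where "a \<noteq> x" "a \<noteq> y" "{{s, t}, {t, r}, {r, s}} = {{x, y}, {y, a}, {a, x}}"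
proof -
  consider "{x, y} = {s, t}" | "{x, y} = {t, r}" | "{x, y} = {r, s}" using assms(4) by blast
  then show ?thesis
  proof cases
    case 1 then show ?thesis using assms(1-3) by (intro that[of r]) (auto simp: doubleton_eq_iff)
  next
    case 2 then show ?thesis using assms(1-3) by (intro that[of s]) (auto simp: doubleton_eq_iff)
  next
    case 3 then show ?thesis using assms(1-3) by (intro that[of t]) (auto simp: doubleton_eq_iff)
  qed
qed

definition triangle :: "'a set set \<Rightarrow> bool" where
  "triangle D \<longleftrightarrow> (\<exists>x y z. x \<noteq> y \<and> y \<noteq> z \<and> z \<noteq> x \<and> D = {{x, y}, {y, z}, {z, x}})"

text \<open>At most three edges that do not form a triangle make a forest. Without a leaf, an edge
  \<open>ab\<close> would extend at both ends to \<open>c b a d\<close>, using up all edges; a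
  further edge at \<open>c\<close> forces \<open>c = d\<close> and a triangle.\<close>

lemma small_graph_leaf:
  assumes "simple_graph V D" "D \<noteq> {}" "card D \<le> 3" "\<not> triangle D"
  shows "\<exists>u v. {u, v} \<in> D \<and> u \<noteq> v \<and> (\<forall>e\<in>D. v \<in> e \<longrightarrow> e = {u, v})"
proof (rule ccontr)
  assume none: "\<not> ?thesis"
  have no: "\<exists>e\<in>D. v \<in> e \<and> e \<noteq> {u, v}" if "{u, v} \<in> D" "u \<noteq> v" for u v
    using none that by metis
  have two: "\<exists>u v. e = {u, v} \<and> u \<noteq> v" if "e \<in> D" for e
    using assms(1) that by (auto simp: simple_graph_def card_2_iff)
  have next_edge: "\<exists>w. {v, w} \<in> D \<and> w \<noteq> u \<and> w \<noteq> v" if uv: "{u, v} \<in> D" "u \<noteq> v" for u v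
  proof -
    obtain e where e: "e \<in> D" "v \<in> e" "e \<noteq> {u, v}" using no[OF uv] by blast
    obtain s t where "e = {s, t}" "s \<noteq> t" using two[OF e(1)] by blast
    with e show ?thesis by (cases "v = s") (auto simp: insert_commute)
  qed
  have finD: "finite D"
    using assms(1) finite_subset[of D "Pow V"] by (auto simp: simple_graph_def)
  obtain e where "e \<in> D" using assms(2) by blast
  then obtain a b where ab: "{a, b} \<in> D" "a \<noteq> b" using two by metis
  obtain c where c: "{b, c} \<in> D" "c \<noteq> a" "c \<noteq> b" using next_edge[OF ab] by blast
  have "{b, a} \<in> D" using ab by (simp add: insert_commute)
  then obtain d where d: "{a, d} \<in> D" "d \<noteq> b" "d \<noteq> a" using next_edge[of b a] ab by blast
  have "card {{a, b}, {b, c}, {a, d}} = 3" using ab c d by (simp add: doubleton_eq_iff)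
  then have D: "D = {{a, b}, {b, c}, {a, d}}"
    using card_seteq[OF finD, of "{{a, b}, {b, c}, {a, d}}"] assms(3) ab c d by simp
  obtain w where "{c, w} \<in> D" "w \<noteq> b" "w \<noteq> c" using next_edge[OF c(1)] c by blast
  then have "c = d" using c ab d unfolding D by (auto simp: doubleton_eq_iff)
  then have "D = {{a, b}, {b, c}, {c, a}}" using D by (simp add: insert_commute)
  then show False using assms(4) ab c unfolding triangle_def by blast
qed

text \<open>A forest does not separate the plane. Leaf edges are removed one by one: an arc does not
  separate, and by Janiszewski's theorem neither does its union with a compact non-separating set
  that it meets in a connected set.\<close>

lemma small_skeleton_connected:
  assumes "plane_graph V D p \<gamma>" "card D \<le> 3" "\<not> triangle D"
  shows "connected (- skeleton p \<gamma> V D)"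
  using assms
proof (induction "card D" arbitrary: V D)
  case 0
  interpret plane_graph V D p \<gamma> by (rule 0(2))
  have "D = {}" using 0(1)[symmetric] by simp
  then show ?case by (simp add: skeleton_def connected_Compl_finite)
next
  case (Suc n)
  interpret plane_graph V D p \<gamma> by (rule Suc.prems(1))
  have "D \<noteq> {}" using Suc.hyps(2) by auto
  then obtain u v where uv: "{u, v} \<in> D" "u \<noteq> v" and leaf: "\<And>e. e \<in> D \<Longrightarrow> v \<in> e \<Longrightarrow> e = {u, v}"
    using small_graph_leaf[OF simple _ Suc.prems(2,3)] by blast
  \<comment> \<open>The leaf goes together with its edge: only then does the remaining skeleton meet
    the arc in the single point \<open>p u\<close>.\<close>
  let ?V = "V - {v}" and ?D = "D - {{u, v}}" and ?T = "path_image (\<gamma> {u, v})"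
  interpret D: plane_graph ?V ?D p \<gamma>
  proof
    show "simple_graph ?V ?D"
      using simple leaf unfolding simple_graph_def by auto
    have "p ` V - {p v} = p ` ?V"
      using inj_p edge_verts[OF uv(1)] by (auto dest: inj_onD)
    then have "path_image (\<gamma> e) \<inter> p ` ?V = p ` e" if "e \<in> ?D" for e
      using that edge_Int_verts[of e] leaf[of e] inj_p edge_verts[OF uv(1)] edge_subset[of e]
      by (auto dest: inj_onD)
    moreover have "inj_on p ?V" using inj_p by (rule inj_on_subset) auto
    ultimately show "plane_drawing ?V ?D p \<gamma>"
      using arc_edge edge_ends edge_Int unfolding plane_drawing_def by auto
  qed
  have card: "card D = Suc (card ?D)" by (rule card.remove[OF finite_E uv(1)])
  have "\<not> triangle ?D"
    using card Suc.prems(2) card_triangle unfolding triangle_def by (metis Suc_n_not_le_n numeral_3_eq_3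
        Suc_le_mono eval_nat_numeral(3))
  then have conn: "connected (- skeleton p \<gamma> ?V ?D)"
    using card Suc.prems(2) Suc.hyps by (intro Suc.hyps(1) D.plane_graph_axioms) auto
  have "p v \<notin> skeleton p \<gamma> ?V ?D"
  proof
    assume "p v \<in> skeleton p \<gamma> ?V ?D"
    then consider "p v \<in> p ` ?V" | e where "e \<in> ?D" "p v \<in> path_image (\<gamma> e)"
      by (auto simp: skeleton_def)
    then show False
    proof cases
      case 1 then show ?thesis using inj_p edge_verts[OF uv(1)] by (auto dest: inj_onD)
    next
      case 2
      then have "p v \<in> p ` e" using edge_Int_verts[of e] edge_verts[OF uv(1)] by blast
      then have "v \<in> e" using inj_p edge_verts[OF uv(1)] edge_subset[of e] 2(1) by (auto dest: inj_onD)
      then show ?thesis using leaf 2(1) by blast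
    qed
  qed
  moreover have "p u \<in> skeleton p \<gamma> ?V ?D"
    using uv edge_verts[OF uv(1)] by (auto simp: skeleton_def)
  moreover have "skeleton p \<gamma> ?V ?D \<subseteq> skeleton p \<gamma> V ?D" by (auto simp: skeleton_def)
  ultimately have "skeleton p \<gamma> ?V ?D \<inter> ?T = {p u}"
    using edge_Int_skeleton[OF uv(1)] by auto
  moreover have "arc (\<gamma> {u, v})" by (rule arc_edge[OF uv(1)])
  ultimately have "connected (- (skeleton p \<gamma> ?V ?D \<union> ?T))"
    using conn by (intro Janiszewski_connected D.compact_skeleton connected_arc_complement
        closed_path_image arc_imp_path) auto
  moreover have "skeleton p \<gamma> ?V ?D \<union> ?T = skeleton p \<gamma> V D"
    using edge_Int_verts[OF uv(1)] uv(1) unfolding skeleton_def by blast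
  ultimately show ?case by simp
qed

context plane_graph
begin

lemma edge_faces_two:
  assumes "bridgeless E" "e \<in> E"
  obtains A B F where "edge_faces p \<gamma> V E e = {A, B}" "A \<noteq> B"
    "A \<in> faces p \<gamma> V E" "B \<in> faces p \<gamma> V E"
    "path_image (\<gamma> e) \<subseteq> closure A" "path_image (\<gamma> e) \<subseteq> closure B"
    "open F" "path_image (\<gamma> e) - p ` e \<subseteq> F"
    "F \<subseteq> A \<union> B \<union> (path_image (\<gamma> e) - p ` e)"
proof -
  from assms(2) obtain u v where uv: "e = {u, v}" by (rule edgeE)
  then have e: "{u, v} \<in> E" using assms(2) by simp
  then have "linked (E - {{u, v}}) u v" using assms(1) by (simp add: bridgeless_def)
  from e this obtain P where P: "arc P" "pathstart P = p v" "pathfinish P = p u"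
    "path_image P \<subseteq> skeleton p \<gamma> V (E - {{u, v}})"
    by (rule return_arc)
  show ?thesis unfolding uv
    by (rule edge_sides[OF e P]) (rule that[unfolded uv])
qed

lemma edge_face_closure:
  assumes "bridgeless E" "e \<in> E" "A \<in> edge_faces p \<gamma> V E e"
  shows "path_image (\<gamma> e) \<subseteq> closure A"
  by (rule edge_faces_two[OF assms(1,2)]) (use assms(3) in auto)

lemma edge_faces_eq:
  assumes "bridgeless E" "e \<in> E" "A \<in> edge_faces p \<gamma> V E e" "B \<in> edge_faces p \<gamma> V E e" "A \<noteq> B"
  shows "edge_faces p \<gamma> V E e = {A, B}"
  by (rule edge_faces_two[OF assms(1,2)]) (use assms(3-5) in auto)

lemma face_closure_subset_face_edges:
  assumes "A \<in> faces p \<gamma> V E"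
  shows "closure A \<subseteq> A \<union> skeleton p \<gamma> V (face_edges p \<gamma> V E A)"
proof
  fix x assume x: "x \<in> closure A"
  show "x \<in> A \<union> skeleton p \<gamma> V (face_edges p \<gamma> V E A)"
  proof (cases "x \<in> A \<or> x \<in> p ` V")
    case False
    then have "x \<in> skeleton p \<gamma> V E" using face_closure_subset[OF assms] x by blast
    then obtain e where e: "e \<in> E" "x \<in> path_image (\<gamma> e)" using False by (auto simp: skeleton_def)
    moreover have "x \<notin> p ` e" using False edge_subset[OF e(1)] by blast
    ultimately have "e \<in> face_edges p \<gamma> V E A"
      using assms x unfolding face_edges_def edge_faces_def by blast
    then show ?thesis using e by (auto simp: skeleton_def)
  qed (auto simp: skeleton_def)
qed

text \<open>So few edges, if not a triangle, do not separate the plane, and \<open>A\<close> would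
  be the whole complement of their skeleton. That leaves no room for the second face which lies
  along any edge of \<open>E\<close>.\<close>

lemma face_edges_small:
  assumes "bridgeless E" "E \<noteq> {}" "A \<in> faces p \<gamma> V E" "card (face_edges p \<gamma> V E A) \<le> 3"
  shows "triangle (face_edges p \<gamma> V E A)"
proof (rule ccontr)
  let ?D = "face_edges p \<gamma> V E A"
  assume "\<not> triangle ?D"
  have sub: "?D \<subseteq> E" by (auto simp: face_edges_def)
  interpret D: plane_graph V ?D p \<gamma> by (rule subgraph[OF sub])
  have skel: "skeleton p \<gamma> V ?D \<subseteq> skeleton p \<gamma> V E" using sub by (auto simp: skeleton_def)
  have "A = - skeleton p \<gamma> V ?D"
  proof (rule clopen_in_complement)
    show "connected (- skeleton p \<gamma> V ?D)"
      using D.plane_graph_axioms assms(4) \<open>\<not> triangle ?D\<close> by (rule small_skeleton_connected)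
    show "A \<inter> skeleton p \<gamma> V ?D = {}" using face_Int_skeleton[OF assms(3)] skel by blast
  qed (use open_face face_nonempty face_closure_subset_face_edges assms(3) in auto)
  moreover obtain e where e: "e \<in> E" using assms(2) by blast
  obtain B where B: "B \<in> faces p \<gamma> V E" "B \<noteq> A"
    by (rule edge_faces_two[OF assms(1) e]) metis
  ultimately have "B \<subseteq> A" using face_Int_skeleton[OF B(1)] skel by blast
  then show False using faces_disjoint[OF B(1) assms(3)] B(2) face_nonempty[OF B(1)] by blast
qed

text \<open>The closures of such faces form a set that is open and closed in the plane minus the finitely many vertices.\<close>

lemma closed_face_family:
  assumes "bridgeless E" "finite \<C>" "\<C> \<noteq> {}" "\<C> \<subseteq> faces p \<gamma> V E"
    and cl: "\<And>A e. A \<in> \<C> \<Longrightarrow> e \<in> face_edges p \<gamma> V E A \<Longrightarrow> edge_faces p \<gamma> V E e \<subseteq> \<C>"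
  shows "faces p \<gamma> V E \<subseteq> \<C>"
proof -
  define U where "U = (\<Union>A\<in>\<C>. closure A) - p ` V"
  have AU: "A \<subseteq> U" if "A \<in> \<C>" for A
    using that assms(4) face_Int_skeleton[of A] closure_subset[of A] unfolding U_def skeleton_def by blast
  have "open U"
  proof (subst open_subopen, intro ballI)
    fix z assume z: "z \<in> U"
    then obtain A where A: "A \<in> \<C>" "z \<in> closure A" "z \<notin> p ` V" by (auto simp: U_def)
    have face: "A \<in> faces p \<gamma> V E" using A assms(4) by blast
    show "\<exists>T. open T \<and> z \<in> T \<and> T \<subseteq> U"
    proof (cases "z \<in> A")
      case True
      then show ?thesis using AU[OF A(1)] open_face[OF face] by blast
    next
      case False
      then obtain e where e: "e \<in> face_edges p \<gamma> V E A" "z \<in> path_image (\<gamma> e)"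
        using face_closure_subset_face_edges[OF face] A by (auto simp: skeleton_def)
      then have eE: "e \<in> E" by (simp add: face_edges_def)
      \<comment> \<open>The open set \<open>F\<close> around the interior of the edge lies in the
        closures of the two faces along it, both in \<open>\<C>\<close>, so \<open>z\<close> is an
        interior point.\<close>
      obtain C D F where F: "edge_faces p \<gamma> V E e = {C, D}"
        "path_image (\<gamma> e) \<subseteq> closure C" "open F" "path_image (\<gamma> e) - p ` e \<subseteq> F"
        "F \<subseteq> C \<union> D \<union> (path_image (\<gamma> e) - p ` e)"
        by (rule edge_faces_two[OF assms(1) eE])
      have CD: "C \<in> \<C>" "D \<in> \<C>" using cl[OF A(1) e(1)] F(1) by auto
      have "F \<subseteq> closure C \<union> closure D"
        using F(2,5) closure_subset[of C] closure_subset[of D] by blast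
      also have "\<dots> \<subseteq> (\<Union>A\<in>\<C>. closure A)" using CD by blast
      finally have "F - p ` V \<subseteq> U" by (auto simp: U_def)
      moreover have "open (F - p ` V)" using F(3) by (simp add: finite_imp_closed open_Diff)
      moreover have "z \<in> F - p ` V" using e(2) A(3) F(4) edge_subset[OF eE] by blast
      ultimately show ?thesis by blast
    qed
  qed
  moreover have "closure U \<subseteq> U \<union> p ` V"
  proof -
    have "closure U \<subseteq> (\<Union>A\<in>\<C>. closure A)"
      using assms(2) by (intro closure_minimal closed_UN) (auto simp: U_def)
    then show ?thesis by (auto simp: U_def)
  qed
  moreover have "U \<noteq> {}"
    using assms(3,4) AU face_nonempty by blast
  moreover have "connected (- (p ` V))" by (simp add: connected_Compl_finite)
  ultimately have U: "U = - (p ` V)" by (intro clopen_in_complement) (auto simp: U_def)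
  show ?thesis
  proof
    fix B assume B: "B \<in> faces p \<gamma> V E"
    then obtain x where x: "x \<in> B" using face_nonempty by blast
    then have xs: "x \<notin> skeleton p \<gamma> V E" using face_Int_skeleton[OF B] by blast
    then have "x \<in> U" using U by (auto simp: skeleton_def)
    then obtain A where A: "A \<in> \<C>" "x \<in> closure A" by (auto simp: U_def)
    then have "x \<in> A" using xs face_closure_subset[of A] assms(4) by blast
    then show "B \<in> \<C>" using faces_disjoint[OF B _ x] A(1) assms(4) by blast
  qed
qed

text \<open>\<open>A\<close> and \<open>B\<close> lie on different sides of the closed curve \<open>yaz\<close>, hence so do \<open>x\<close> and \<open>b\<close>.\<close>

lemma triangle_separates:
  assumes E: "{y, z} \<in> E" "{y, a} \<in> E" "{a, z} \<in> E" "{b, x} \<in> E"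
    and AB: "A \<in> edge_faces p \<gamma> V E {y, z}" "B \<in> edge_faces p \<gamma> V E {y, z}" "A \<noteq> B"
    and cl: "p x \<in> closure A" "p b \<in> closure B"
    and ne: "x \<notin> {y, a, z}" "b \<notin> {y, a, z}"
  shows False
proof -
  obtain g1 where g1: "arc g1" "pathstart g1 = p z" "pathfinish g1 = p a"
      "path_image g1 = path_image (\<gamma> {a, z})"
    using edge_arc[of z a] E(3) by (metis insert_commute)
  obtain g2 where g2: "arc g2" "pathstart g2 = p a" "pathfinish g2 = p y"
      "path_image g2 = path_image (\<gamma> {y, a})"
    using edge_arc[of a y] E(2) by (metis insert_commute)
  \<comment> \<open>\<open>P\<close> runs from \<open>z\<close> through \<open>a\<close> to
    \<open>y\<close> and closes the edge \<open>yz\<close> to the curve around the triangle.\<close>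
  define P where "P = g1 +++ g2"
  have yaz: "y \<noteq> a" "a \<noteq> z" "y \<noteq> z" using edge_distinct E by auto
  have "path_image g1 \<inter> path_image g2 = p ` ({a, z} \<inter> {y, a})"
    using edge_Int[OF E(3,2)] g1(4) g2(4) yaz by (auto simp: doubleton_eq_iff)
  also have "{a, z} \<inter> {y, a} = {a}" using yaz by auto
  finally have "arc P" unfolding P_def using g1 g2 by (intro arc_join) auto
  have ends: "pathstart P = p z" "pathfinish P = p y" using g1 g2 by (simp_all add: P_def)
  have img: "path_image P = path_image (\<gamma> {a, z}) \<union> path_image (\<gamma> {y, a})"
    using g1 g2 by (simp add: P_def path_image_join)
  have "path_image P \<subseteq> skeleton p \<gamma> V (E - {{y, z}})"
    using E yaz unfolding img skeleton_def by (auto simp: doubleton_eq_iff)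
  let ?J = "path_image (\<gamma> {y, z}) \<union> path_image P"
  obtain C D where CD: "edge_faces p \<gamma> V E {y, z} = {C, D}" "C \<subseteq> inside ?J" "D \<subseteq> outside ?J"
    by (rule edge_sides[OF E(1) \<open>arc P\<close> ends \<open>path_image P \<subseteq> _\<close>])
  have J: "closed ?J"
    unfolding img using E by (intro closed_Un closed_path_image arc_imp_path arc_edge)
  have avoid: "path_image (\<gamma> {b, x}) \<inter> path_image (\<gamma> e) = {}"
    if "e \<in> {{y, z}, {y, a}, {a, z}}" for e
  proof -
    have "e \<noteq> {b, x}" "{b, x} \<inter> e = {}" using that ne by auto
    then show ?thesis using edge_Int[OF E(4), of e] that E by auto
  qed
  then have dis: "path_image (\<gamma> {b, x}) \<inter> ?J = {}" unfolding img by blast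
  have ends_bx: "p b \<in> path_image (\<gamma> {b, x})" "p x \<in> path_image (\<gamma> {b, x})"
    using edge_Int_verts[OF E(4)] by auto
  have conn: "connected (path_image (\<gamma> {b, x}))"
    by (intro connected_path_image arc_imp_path arc_edge E)
  have cin: "closure (inside ?J) \<subseteq> inside ?J \<union> ?J"
    using closure_inside_subset[OF J] by blast
  have cout: "closure (outside ?J) \<subseteq> outside ?J \<union> ?J"
    using closure_outside_subset[OF J] by blast
  have "inside ?J \<inter> path_image (\<gamma> {b, x}) \<noteq> {} \<and> outside ?J \<inter> path_image (\<gamma> {b, x}) \<noteq> {}"
  proof -
    have "p x \<notin> ?J" "p b \<notin> ?J" using dis ends_bx by auto
    moreover have "A = C \<and> B = D \<or> A = D \<and> B = C" using AB CD(1) by auto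
    ultimately show ?thesis
      using cl closure_mono[OF CD(2)] closure_mono[OF CD(3)] cin cout ends_bx by blast
  qed
  moreover have "path_image (\<gamma> {b, x}) \<subseteq> inside ?J \<union> outside ?J"
    using dis inside_Un_outside[of ?J] by blast
  moreover have "open (inside ?J)" "open (outside ?J)" using J open_inside open_outside by auto
  ultimately show False
    using connectedD[OF conn, of "inside ?J" "outside ?J"] inside_Int_outside[of ?J] by blast
qed

text \<open>\<open>A\<close> is the face in \<open>xyz\<close>, \<open>a\<close> the apex across
  \<open>xy\<close>, and \<open>b\<close> the apex of the face \<open>B\<close> across
  \<open>yz\<close>. If \<open>a \<noteq> b\<close>, theta closedness yields the edges
  \<open>za\<close> and \<open>xb\<close>, and \<open>triangle_separates\<close> applies to the
  curve \<open>yaz\<close>.\<close>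

lemma adjacent_triangle_apex:
  assumes bl: "bridgeless E" and th: "theta_closed E"
    and E: "{x, y} \<in> E" "{y, z} \<in> E" "{z, x} \<in> E" "{x, a} \<in> E" "{y, a} \<in> E" "{z, b} \<in> E" "{y, b} \<in> E"
    and A: "A \<in> edge_faces p \<gamma> V E {x, y}" "A \<in> edge_faces p \<gamma> V E {y, z}"
    and B: "B \<in> edge_faces p \<gamma> V E {y, z}" "B \<in> edge_faces p \<gamma> V E {z, b}" "B \<noteq> A"
    and ne: "a \<noteq> z" "b \<noteq> x"
  shows "a = b"
proof (rule ccontr)
  assume "a \<noteq> b"
  have za: "{z, a} \<in> E" using th E ne unfolding theta_closed_def by blast
  have "{x, b} \<in> E" using th E ne unfolding theta_closed_def by blast
  then have bx: "{b, x} \<in> E" by (simp add: insert_commute)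
  have "p x \<in> closure A"
    using edge_face_closure[OF bl E(1) A(1)] edge_Int_verts[OF E(1)] by blast
  moreover have "p b \<in> closure B"
    using edge_face_closure[OF bl E(6) B(2)] edge_Int_verts[OF E(6)] by blast
  moreover have "x \<notin> {y, a, z}" "b \<notin> {y, a, z}"
    using edge_distinct[OF E(1)] edge_distinct[OF E(3)] edge_distinct[OF E(4)]
      edge_distinct[OF E(6)] edge_distinct[OF E(7)] \<open>a \<noteq> b\<close> by auto
  ultimately show False
    using triangle_separates[OF E(2) E(5) _ bx A(2) B(1)] za B(3) by (auto simp: insert_commute)
qed

end

subsection \<open>Counting faces\<close>

lemma card_filter_sum:
  assumes "finite S"
  shows "card {x \<in> S. P x} = (\<Sum>x\<in>S. if P x then 1 else 0)"
  using assms by (simp flip: sum.inter_filter)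

context plane_graph
begin

lemma edge_faces_subset: "edge_faces p \<gamma> V E e \<subseteq> faces p \<gamma> V E"
  by (auto simp: edge_faces_def)

text \<open>Either some neighbour has the same three edges as \<open>A\<close>, or all apexes agree
  and \<open>A\<close> and its neighbours are the four faces of a plane \<open>K4\<close>. In both
  cases crossing an edge stays within the family, so by \<open>closed_face_family\<close> there is
  no other face.\<close>

lemma shared_triangle_few_faces:
  assumes bl: "bridgeless E" and th: "theta_closed E"
    and A: "A \<in> faces p \<gamma> V E" "triangle (face_edges p \<gamma> V E A)"
    and shared: "\<And>e. e \<in> face_edges p \<gamma> V E A \<Longrightarrow>
      \<exists>B\<in>edge_faces p \<gamma> V E e. B \<noteq> A \<and> triangle (face_edges p \<gamma> V E B)"
  shows "\<exists>\<C>. finite \<C> \<and> card \<C> \<le> 4 \<and> faces p \<gamma> V E \<subseteq> \<C>"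
proof -
  let ?fe = "face_edges p \<gamma> V E" and ?ef = "edge_faces p \<gamma> V E"
  have fe: "e \<in> ?fe B \<longleftrightarrow> e \<in> E \<and> B \<in> ?ef e" for e B by (simp add: face_edges_def)
  have pair: "?ef e \<subseteq> \<C>" if "e \<in> ?fe B" "e \<in> ?fe C" "B \<noteq> C" "B \<in> \<C>" "C \<in> \<C>" for e B C \<C>
    using edge_faces_eq[OF bl, of e B C] that fe by auto
  \<comment> \<open>An edge borders exactly two faces, so the family is closed as soon as each edge
    of a listed face borders another listed face.\<close>
  have close: "\<exists>\<C>. finite \<C> \<and> card \<C> \<le> 4 \<and> faces p \<gamma> V E \<subseteq> \<C>"
    if Cs: "set Cs \<subseteq> faces p \<gamma> V E" "length Cs \<le> 4" "Cs \<noteq> []"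
      "\<And>B e. B \<in> set Cs \<Longrightarrow> e \<in> ?fe B \<Longrightarrow> \<exists>C\<in>set Cs. C \<noteq> B \<and> e \<in> ?fe C" for Cs
  proof (intro exI[of _ "set Cs"] conjI)
    show "card (set Cs) \<le> 4" using card_length[of Cs] Cs(2) by simp
    show "faces p \<gamma> V E \<subseteq> set Cs"
    proof (rule closed_face_family[OF bl])
      fix B e assume *: "B \<in> set Cs" "e \<in> ?fe B"
      then obtain C where "C \<in> set Cs" "C \<noteq> B" "e \<in> ?fe C" using Cs(4) by blast
      with * show "?ef e \<subseteq> set Cs" by (intro pair[of e B C]) auto
    qed (use Cs(1,3) in auto)
  qed simp
  obtain x y z where xyz: "x \<noteq> y" "y \<noteq> z" "z \<noteq> x" and fA: "?fe A = {{x, y}, {y, z}, {z, x}}"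
    using A(2) unfolding triangle_def by blast
  have apex: "\<exists>B a. B \<in> faces p \<gamma> V E \<and> B \<noteq> A \<and> ?fe B = {{s, t}, {t, a}, {a, s}} \<and> a \<noteq> s \<and> a \<noteq> t"
    if st: "{s, t} \<in> ?fe A" for s t
  proof -
    obtain B where B: "B \<in> ?ef {s, t}" "B \<noteq> A" "triangle (?fe B)" using shared[OF st] by blast
    then have "{s, t} \<in> ?fe B" using st fe by blast
    moreover obtain i j k where "i \<noteq> j" "j \<noteq> k" "k \<noteq> i" "?fe B = {{i, j}, {j, k}, {k, i}}"
      using B(3) unfolding triangle_def by blast
    ultimately obtain a where "a \<noteq> s" "a \<noteq> t" "?fe B = {{s, t}, {t, a}, {a, s}}"
      using triangle_containing[of i j k s t] by metis
    then show ?thesis using B edge_faces_subset by blast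
  qed
  obtain B1 a where B1: "B1 \<in> faces p \<gamma> V E" "B1 \<noteq> A" "?fe B1 = {{x, y}, {y, a}, {a, x}}" "a \<noteq> x" "a \<noteq> y"
    using apex[of x y] fA by auto
  obtain B2 b where B2: "B2 \<in> faces p \<gamma> V E" "B2 \<noteq> A" "?fe B2 = {{y, z}, {z, b}, {b, y}}" "b \<noteq> y" "b \<noteq> z"
    using apex[of y z] fA by auto
  obtain B3 c where B3: "B3 \<in> faces p \<gamma> V E" "B3 \<noteq> A" "?fe B3 = {{z, x}, {x, c}, {c, z}}" "c \<noteq> z" "c \<noteq> x"
    using apex[of z x] fA by auto
  \<comment> \<open>This settles the case where an apex is the third vertex of
    \<open>A\<close>.\<close>
  have twin: ?thesis if "B \<in> faces p \<gamma> V E" "B \<noteq> A" "?fe B = ?fe A" for B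
    by (rule close[of "[A, B]"]) (use that A(1) in auto)
  consider "a = z" | "b = x" | "c = y" | "a \<noteq> z" "b \<noteq> x" "c \<noteq> y" by blast
  then show ?thesis
  proof cases
    case 1 then show ?thesis using twin[OF B1(1,2)] B1(3) fA by (auto simp: insert_commute)
  next
    case 2 then show ?thesis using twin[OF B2(1,2)] B2(3) fA by (auto simp: insert_commute)
  next
    case 3 then show ?thesis using twin[OF B3(1,2)] B3(3) fA by (auto simp: insert_commute)
  next
    case 4
    have mA: "{x, y} \<in> ?fe A" "{y, z} \<in> ?fe A" "{z, x} \<in> ?fe A" using fA by auto
    have m1: "{x, y} \<in> ?fe B1" "{y, a} \<in> ?fe B1" "{x, a} \<in> ?fe B1"
      using B1(3) by (auto simp: insert_commute)
    have m2: "{y, z} \<in> ?fe B2" "{z, b} \<in> ?fe B2" "{y, b} \<in> ?fe B2"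
      using B2(3) by (auto simp: insert_commute)
    have m3: "{z, x} \<in> ?fe B3" "{x, c} \<in> ?fe B3" "{z, c} \<in> ?fe B3"
      using B3(3) by (auto simp: insert_commute)
    note m = mA m1 m2 m3
    have ab: "a = b"
      using m[unfolded fe] B2(2) 4 by (intro adjacent_triangle_apex[OF bl th, of x y z a b A B2]) blast+
    have bc: "b = c"
      using m[unfolded fe] B3(2) 4 by (intro adjacent_triangle_apex[OF bl th, of y z x b c A B3]) blast+
    have d: "B1 \<noteq> B2" "B2 \<noteq> B3" "B3 \<noteq> B1"
      using B1(3-5) B2(3-5) B3(3-5) xyz ab bc 4 by (auto simp: doubleton_eq_iff insert_eq_iff)
    \<comment> \<open>All six edges of the \<open>K4\<close> on \<open>x\<close>, \<open>y\<close>,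
      \<open>z\<close>, \<open>a\<close> satisfy \<open>Q\<close>: three are shared with
      \<open>A\<close>, the other three by pairs among \<open>B1\<close>, \<open>B2\<close>,
      \<open>B3\<close>.\<close>
    define Q where "Q e \<longleftrightarrow> (\<exists>C\<in>set [A, B1, B2, B3]. \<exists>D\<in>set [A, B1, B2, B3].
      C \<noteq> D \<and> e \<in> ?fe C \<and> e \<in> ?fe D)" for e
    have Q_intro: "Q e" if "C \<in> set [A, B1, B2, B3]" "D \<in> set [A, B1, B2, B3]" "C \<noteq> D"
      "e \<in> ?fe C" "e \<in> ?fe D" for C D e
      using that unfolding Q_def by blast
    have Q: "Q {x, y}" "Q {y, z}" "Q {z, x}" "Q {y, a}" "Q {x, a}" "Q {z, a}"
    proof -
      show "Q {x, y}" using m B1(2) by (intro Q_intro[of B1 A]) auto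
      show "Q {y, z}" using m B2(2) by (intro Q_intro[of B2 A]) auto
      show "Q {z, x}" using m B3(2) by (intro Q_intro[of B3 A]) auto
      show "Q {y, a}" using m d(1) ab by (intro Q_intro[of B1 B2]) auto
      show "Q {x, a}" using m d(3) ab bc by (intro Q_intro[of B3 B1]) auto
      show "Q {z, a}" using m d(2) ab bc by (intro Q_intro[of B2 B3]) auto
    qed
    show ?thesis
    proof (rule close[of "[A, B1, B2, B3]"])
      fix B e assume *: "B \<in> set [A, B1, B2, B3]" "e \<in> ?fe B"
      from *(1) have "B \<in> {A, B1, B2, B3}" by simp
      moreover have "?fe B1 = {{x, y}, {y, a}, {x, a}}"
        unfolding B1(3) by (simp add: insert_commute[of a x])
      moreover have "?fe B2 = {{y, z}, {z, a}, {y, a}}"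
        unfolding B2(3) ab by (simp add: insert_commute[of b y])
      moreover have "?fe B3 = {{z, x}, {x, a}, {z, a}}"
        unfolding B3(3) ab bc by (simp add: insert_commute[of c z])
      ultimately have "?fe B \<subseteq> {{x, y}, {y, z}, {z, x}, {y, a}, {x, a}, {z, a}}"
        using fA by (elim insertE emptyE; simp)
      with *(2) have "e \<in> {{x, y}, {y, z}, {z, x}, {y, a}, {x, a}, {z, a}}" by (rule subsetD[rotated])
      then have "Q e" using Q by (elim insertE emptyE; simp)
      then obtain C D where "C \<in> set [A, B1, B2, B3]" "D \<in> set [A, B1, B2, B3]" "C \<noteq> D"
        "e \<in> ?fe C" "e \<in> ?fe D"
        unfolding Q_def by blast
      then show "\<exists>C\<in>set [A, B1, B2, B3]. C \<noteq> B \<and> e \<in> ?fe C" by metis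
    qed (use A(1) B1(1) B2(1) B3(1) in auto)
  qed
qed

text \<open>The first alternative covers the families of \<open>shared_triangle_few_faces\<close>.
  Otherwise, with \<open>e\<close> edges, \<open>f\<close> faces and \<open>t\<close> of them
  triangular, counting sides of edges gives \<open>4 t \<le> 2 e\<close> and
  \<open>4 f \<le> 2 e + t\<close>, hence \<open>8 f \<le> 5 e\<close>.\<close>

lemma face_count:
  assumes bl: "bridgeless E" and th: "theta_closed E" and \<F>: "finite \<F>" "\<F> \<subseteq> faces p \<gamma> V E"
  shows "card \<F> \<le> 4 \<or> 8 * card \<F> \<le> 5 * card E"
proof (rule ccontr)
  let ?fe = "face_edges p \<gamma> V E" and ?ef = "edge_faces p \<gamma> V E"
  assume neg: "\<not> ?thesis"
  have few: False if "\<exists>\<C>. finite \<C> \<and> card \<C> \<le> 4 \<and> faces p \<gamma> V E \<subseteq> \<C>"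
    using that \<F> neg card_mono by (meson le_trans subset_trans)
  obtain A where A: "A \<in> \<F>" using neg by (cases "\<F> = {}") auto
  have "E \<noteq> {}"
  proof
    assume "E = {}"
    then have "faces p \<gamma> V E \<subseteq> {A}"
      using A \<F>(2) by (intro closed_face_family[OF bl]) (auto simp: face_edges_def)
    then show False by (intro few exI[of _ "{A}"]) simp
  qed
  note small = face_edges_small[OF bl this]
  define T where "T = {A \<in> \<F>. card (?fe A) = 3}"
  have finT: "finite T" using \<F>(1) by (simp add: T_def)
  have fe3: "3 \<le> card (?fe A)" if "A \<in> faces p \<gamma> V E" for A
  proof (rule ccontr)
    assume "\<not> 3 \<le> card (?fe A)"
    moreover from this have "triangle (?fe A)" using small[OF that] by simp
    ultimately show False unfolding triangle_def by (metis card_triangle order_refl)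
  qed
  have "\<exists>e\<in>?fe A. \<forall>B\<in>?ef e. B \<noteq> A \<longrightarrow> card (?fe B) \<noteq> 3" if "A \<in> T" for A
  proof (rule ccontr)
    assume no: "\<not> ?thesis"
    have face: "A \<in> faces p \<gamma> V E" "card (?fe A) = 3" using that \<F>(2) by (auto simp: T_def)
    have "\<exists>\<C>. finite \<C> \<and> card \<C> \<le> 4 \<and> faces p \<gamma> V E \<subseteq> \<C>"
    proof (rule shared_triangle_few_faces[OF bl th face(1)])
      show "triangle (?fe A)" using small face by simp
      fix e assume "e \<in> ?fe A"
      then obtain B where B: "B \<in> ?ef e" "B \<noteq> A" "card (?fe B) = 3" using no by blast
      then have "triangle (?fe B)" using small[of B] edge_faces_subset by auto
      with B show "\<exists>B\<in>?ef e. B \<noteq> A \<and> triangle (?fe B)" by blast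
    qed
    then show False by (rule few)
  qed
  \<comment> \<open>\<open>h A\<close> is an edge of \<open>A\<close> that no other face with three
    edges shares; this makes \<open>h\<close> injective.\<close>
  then obtain h where h: "\<And>A. A \<in> T \<Longrightarrow> h A \<in> ?fe A"
    "\<And>A B. A \<in> T \<Longrightarrow> B \<in> ?ef (h A) \<Longrightarrow> B \<noteq> A \<Longrightarrow> card (?fe B) \<noteq> 3"
    by metis
  have hE: "h A \<in> E" "A \<in> ?ef (h A)" if "A \<in> T" for A using h(1)[OF that] by (auto simp: face_edges_def)
  have inj: "inj_on h T"
  proof (rule inj_onI)
    fix A B assume AB: "A \<in> T" "B \<in> T" "h A = h B"
    then have "B \<in> ?ef (h A)" using hE by metis
    then show "A = B" using h(2)[OF AB(1)] AB(2) by (auto simp: T_def)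
  qed
  have count: "(\<Sum>A\<in>\<G>. card (?fe A)) = (\<Sum>e\<in>E. card (\<G> \<inter> ?ef e))" if "finite \<G>" for \<G>
  proof -
    have "(\<Sum>A\<in>\<G>. card (?fe A)) = (\<Sum>A\<in>\<G>. \<Sum>e\<in>E. if A \<in> ?ef e then 1 else 0)"
      by (intro sum.cong refl) (simp add: face_edges_def card_filter_sum)
    also have "\<dots> = (\<Sum>e\<in>E. \<Sum>A\<in>\<G>. if A \<in> ?ef e then 1 else 0)" by (rule sum.swap)
    also have "\<dots> = (\<Sum>e\<in>E. card (\<G> \<inter> ?ef e))"
      using that by (intro sum.cong refl) (simp add: Int_def card_filter_sum)
    finally show ?thesis .
  qed
  have two: "card (\<G> \<inter> ?ef e) \<le> 2" if "e \<in> E" for e \<G>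
  proof (rule edge_faces_two[OF bl that])
    fix B C assume "?ef e = {B, C}" "B \<noteq> C"
    then show ?thesis using card_mono[of "{B, C}" "\<G> \<inter> ?ef e"] by auto
  qed
  \<comment> \<open>Every edge has two sides. An edge chosen by \<open>h\<close> has only one face
    of \<open>T\<close> along it, and the unit saved there pays for the extra summand.\<close>
  have "(\<Sum>A\<in>T. card (?fe A)) + card (h ` T) \<le> 2 * card E"
  proof -
    have "card (h ` T) = (\<Sum>e\<in>E. if e \<in> h ` T then 1 else 0)"
      using hE(1) by (subst card_filter_sum[symmetric]) (auto intro!: arg_cong[of _ _ card])
    then have "(\<Sum>A\<in>T. card (?fe A)) + card (h ` T)
        = (\<Sum>e\<in>E. card (T \<inter> ?ef e) + (if e \<in> h ` T then 1 else 0))"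
      using count[OF finT] by (simp only: sum.distrib)
    also have "\<dots> \<le> (\<Sum>e\<in>E. 2)"
    proof (rule sum_mono)
      fix e assume e: "e \<in> E"
      show "card (T \<inter> ?ef e) + (if e \<in> h ` T then 1 else 0) \<le> 2"
      proof (cases "e \<in> h ` T")
        case True
        then obtain A where A: "A \<in> T" "e = h A" by blast
        have "T \<inter> ?ef e \<subseteq> {A}"
        proof
          fix B assume "B \<in> T \<inter> ?ef e"
          then have "B \<in> ?ef (h A)" "card (?fe B) = 3" using A(2) by (simp_all add: T_def)
          then show "B \<in> {A}" using h(2)[OF A(1)] by blast
        qed
        then have "card (T \<inter> ?ef e) \<le> 1" using card_mono[of "{A}"] by simp
        then show ?thesis by simp
      next
        case False then show ?thesis using two[OF e] by simp
      qed
    qed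
    finally show ?thesis by simp
  qed
  moreover have "(\<Sum>A\<in>T. card (?fe A)) = 3 * card T" by (simp add: T_def)
  moreover have "card (h ` T) = card T" using inj by (rule card_image)
  \<comment> \<open>Each face has at least three edges; the indicator of \<open>T\<close> tops those
    with exactly three up to four.\<close>
  moreover have "4 * card \<F> \<le> 2 * card E + card T"
  proof -
    have "4 * card \<F> = (\<Sum>A\<in>\<F>. 4)" by simp
    also have "\<dots> \<le> (\<Sum>A\<in>\<F>. card (?fe A) + (if A \<in> T then 1 else 0))"
    proof (rule sum_mono)
      fix A assume "A \<in> \<F>"
      then show "4 \<le> card (?fe A) + (if A \<in> T then 1 else 0)"
        using fe3[of A] \<F>(2) by (cases "card (?fe A) = 3") (auto simp: T_def)
    qed
    also have "\<dots> = (\<Sum>e\<in>E. card (\<F> \<inter> ?ef e)) + (\<Sum>A\<in>\<F>. if A \<in> T then 1 else 0)"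
      by (simp only: sum.distrib count[OF \<F>(1)])
    also have "(\<Sum>A\<in>\<F>. if A \<in> T then 1 else 0) = card T"
      using \<F>(1) by (subst card_filter_sum[symmetric]) (auto simp: T_def intro!: arg_cong[of _ _ card])
    also have "(\<Sum>e\<in>E. card (\<F> \<inter> ?ef e)) \<le> (\<Sum>e\<in>E. 2)"
      by (rule sum_mono) (rule two)
    finally show ?thesis by simp
  qed
  ultimately show False using neg by linarith
qed

end

section \<open>The edge bound, and theta closedness as absence of an induced subgraph\<close>

lemma planar_theta_closed_bound:
  assumes "planar_graph V E" "theta_closed E" "5 \<le> card V"
  shows "3 * card E + 16 \<le> 8 * card V"
proof -
  obtain p \<gamma> where "plane_graph V E p \<gamma>"
    using assms(1) by (auto simp: planar_graph_def plane_graph_def)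
  then interpret plane_graph V E p \<gamma> .
  obtain E' where E': "E' \<subseteq> E" "bridgeless E'" "theta_closed E'"
    "card E + card (link_classes V E) \<le> card E' + card (link_classes V E')"
    using bridgeless_subgraph[OF simple assms(2)] by blast
  interpret S: plane_graph V E' p \<gamma> by (rule subgraph[OF E'(1)])
  obtain \<F> where \<F>: "finite \<F>" "\<F> \<subseteq> faces p \<gamma> V E'"
    "card E' + card (link_classes V E') + 1 \<le> card V + card \<F>"
    using Euler_inequality[OF S.plane_graph_axioms] by blast
  have "0 < card (link_classes V E)" using assms(3) by (intro card_link_classes_pos) auto
  moreover have "card E' \<le> card E" using E'(1) by (simp add: card_mono)
  \<comment> \<open>As there is at least one class, \<open>e + 2 \<le> n + f\<close>. With
    \<open>8 f \<le> 5 e\<close> the claim follows; with \<open>f \<le> 4\<close> one gets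
    \<open>3 e + 16 \<le> 3 n + 22\<close>, which is at most \<open>8 n\<close> since
    \<open>n \<ge> 5\<close>. For \<open>n = 4\<close> the graph \<open>K4\<close> violates the
    bound.\<close>
  ultimately show ?thesis using S.face_count[OF E'(2,3) \<F>(1,2)] \<F>(3) E'(4) assms(3) by linarith
qed

lemma induced_free_theta4_iff:
  assumes "simple_graph V E"
  shows "induced_free V E theta4_verts theta4_edges \<longleftrightarrow> theta_closed E"
proof
  assume free: "induced_free V E theta4_verts theta4_edges"
  show "theta_closed E"
    unfolding theta_closed_def
  proof (intro allI impI, rule ccontr)
    fix x y z a
    assume E: "{x, y} \<in> E" "{y, z} \<in> E" "{z, x} \<in> E" "{x, a} \<in> E" "{y, a} \<in> E" and "a \<noteq> z" "{z, a} \<notin> E"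
    have card2: "s \<noteq> t" if "{s, t} \<in> E" for s t
      using assms that unfolding simple_graph_def by fastforce
    \<comment> \<open>The isomorphism condition also ranges over \<open>u = v\<close>, where
      \<open>{u, v}\<close> is a singleton.\<close>
    have loop: "{s} \<notin> E" for s
      using card2[of s s] by auto
    have d: "x \<noteq> y" "y \<noteq> z" "z \<noteq> x" "x \<noteq> a" "y \<noteq> a" "a \<noteq> z"
      using E card2 \<open>a \<noteq> z\<close> by blast+
    \<comment> \<open>\<open>x\<close> and \<open>y\<close> become the ends 0 and 2 of the diagonal,
      \<open>z\<close> and \<open>a\<close> the two nonadjacent vertices 1 and 3.\<close>
    define f :: "'a \<Rightarrow> nat" where "f w = (if w = x then 0 else if w = z then 1 else if w = y then 2 else 3)" for w
    have f: "f x = 0" "f z = 1" "f y = 2" "f a = 3" using d by (auto simp: f_def)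
    let ?S = "{x, z, y, a}"
    have "bij_betw f ?S theta4_verts"
      unfolding bij_betw_def inj_on_def theta4_verts_def using f by auto
    moreover have "\<forall>u\<in>?S. \<forall>v\<in>?S. {u, v} \<in> induced_edges E ?S \<longleftrightarrow> {f u, f v} \<in> theta4_edges"
      using f E \<open>{z, a} \<notin> E\<close> loop
      by (auto simp: induced_edges_def theta4_edges_def insert_commute doubleton_eq_iff)
    moreover have "?S \<subseteq> V" using E assms by (auto simp: simple_graph_def)
    ultimately show False using free unfolding induced_free_def graph_iso_def by blast
  qed
next
  assume th: "theta_closed E"
  show "induced_free V E theta4_verts theta4_edges"
    unfolding induced_free_def graph_iso_def
  proof (intro notI, elim exE conjE)
    fix S f
    assume S: "S \<subseteq> V" and bij: "bij_betw f S theta4_verts"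
      and iso: "\<forall>u\<in>S. \<forall>v\<in>S. {u, v} \<in> induced_edges E S \<longleftrightarrow> {f u, f v} \<in> theta4_edges"
    have "\<exists>u\<in>S. f u = i" if "i \<in> theta4_verts" for i
      using bij_betw_imp_surj_on[OF bij] that by (metis imageE)
    then obtain x z y a where w: "x \<in> S" "z \<in> S" "y \<in> S" "a \<in> S" "f x = 0" "f z = 1" "f y = 2" "f a = 3"
      unfolding theta4_verts_def by (metis insertI1 insertI2)
    have edge: "{u, v} \<in> E \<longleftrightarrow> {f u, f v} \<in> theta4_edges" if "u \<in> S" "v \<in> S" for u v
      using iso that by (auto simp: induced_edges_def)
    have "{x, y} \<in> E" "{y, z} \<in> E" "{z, x} \<in> E" "{x, a} \<in> E" "{y, a} \<in> E" "{z, a} \<notin> E"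
      using w by (simp_all add: edge theta4_edges_def doubleton_eq_iff)
    moreover have "a \<noteq> z" using w by auto
    ultimately show False using th unfolding theta_closed_def by blast
  qed
qed

subsection \<open>Parallel copies of the stacked cuboctahedron\<close>

type_synonym ipt = "int \<times> int"

definition pt :: "ipt \<Rightarrow> complex" where
  "pt q = Complex (of_int (fst q)) (of_int (snd q))"

text \<open>Twice the signed area of the triangle \<open>pqr\<close>; its sign tells on which side
  of the line \<open>pq\<close> the point \<open>r\<close> lies.\<close>

definition orient :: "ipt \<Rightarrow> ipt \<Rightarrow> ipt \<Rightarrow> int" where
  "orient p q r = (fst q - fst p) * (snd r - snd p) - (snd q - snd p) * (fst r - fst p)"

definition same_side :: "ipt \<Rightarrow> ipt \<Rightarrow> ipt \<Rightarrow> ipt \<Rightarrow> bool" where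
  "same_side p q r s \<longleftrightarrow>
     0 < orient p q r \<and> 0 < orient p q s \<or> orient p q r < 0 \<and> orient p q s < 0"

text \<open>A sufficient condition, decidable on integers, for two segments to meet only in common
  ends. Without a common end, one segment has to lie strictly on one side of the line through the
  other.\<close>

fun segments_ok :: "ipt \<times> ipt \<Rightarrow> ipt \<times> ipt \<Rightarrow> bool" where
  "segments_ok (p, q) (r, s) \<longleftrightarrow>
     (if p = r then orient p q s \<noteq> 0
      else if p = s then orient p q r \<noteq> 0
      else if q = r then orient q p s \<noteq> 0
      else if q = s then orient q p r \<noteq> 0
      else same_side p q r s \<or> same_side r s p q)"

lemma inj_pt: "inj pt"
  by (auto simp: inj_def pt_def prod_eq_iff)

text \<open>The left side extends \<open>orient p q\<close> to real points \<open>z\<close>. It is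
  affine in \<open>z\<close>, so along a segment it interpolates between the values at the
  ends.\<close>

lemma closed_segment_orient:
  assumes "z \<in> closed_segment (pt r) (pt s)"
  obtains u where "0 \<le> u" "u \<le> 1"
    "\<And>p q. of_int (fst q - fst p) * (Im z - of_int (snd p)) - of_int (snd q - snd p) * (Re z - of_int (fst p))
       = (1 - u) * of_int (orient p q r) + u * of_int (orient p q s)"
    "z = (1 - u) *\<^sub>R pt r + u *\<^sub>R pt s"
proof -
  obtain u where u: "0 \<le> u" "u \<le> 1" "z = (1 - u) *\<^sub>R pt r + u *\<^sub>R pt s"
    using assms by (auto simp: in_segment)
  show ?thesis
    by (rule that[OF u(1,2) _ u(3)]) (simp add: u(3) pt_def orient_def algebra_simps)
qed

lemma orient_degenerate [simp]: "orient p q p = 0" "orient p q q = 0"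
  by (simp_all add: orient_def)

text \<open>The affine function vanishes on the first segment and keeps a strict sign on the
  second.\<close>

lemma same_side_disjoint:
  assumes "same_side p q r s"
  shows "closed_segment (pt p) (pt q) \<inter> closed_segment (pt r) (pt s) = {}"
proof (rule equals0I)
  fix z assume z: "z \<in> closed_segment (pt p) (pt q) \<inter> closed_segment (pt r) (pt s)"
  let ?L = "of_int (fst q - fst p) * (Im z - of_int (snd p)) - of_int (snd q - snd p) * (Re z - of_int (fst p))"
  from z obtain v where "?L = (1 - v) * of_int (orient p q p) + v * of_int (orient p q q)"
    using closed_segment_orient[of z p q] by blast
  then have "?L = 0" by simp
  moreover from z obtain u where u: "0 \<le> u" "u \<le> 1"
      "?L = (1 - u) * of_int (orient p q r) + u * of_int (orient p q s)"
    using closed_segment_orient[of z r s] by (metis IntD2)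
  ultimately have eq: "(1 - u) * of_int (orient p q r) + u * of_int (orient p q s) = 0" by simp
  have pos: "0 < (1 - u) * a + u * b" if "0 < a" "0 < b" for a b :: real
    using u(1,2) that by (cases "u = 0") (auto intro: add_nonneg_pos)
  from assms show False
    unfolding same_side_def
  proof
    assume "0 < orient p q r \<and> 0 < orient p q s"
    then show False using pos[of "of_int (orient p q r)" "of_int (orient p q s)"] eq by simp
  next
    assume "orient p q r < 0 \<and> orient p q s < 0"
    then show False
      using pos[of "- of_int (orient p q r)" "- of_int (orient p q s)"] eq by simp
  qed
qed

text \<open>Along the second segment the affine function is \<open>u\<close> times a nonzero number,
  so it vanishes only at \<open>u = 0\<close>, the common end.\<close>

lemma orient_common_end:
  assumes "orient p q s \<noteq> 0"
  shows "closed_segment (pt p) (pt q) \<inter> closed_segment (pt p) (pt s) = {pt p}"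
proof
  show "closed_segment (pt p) (pt q) \<inter> closed_segment (pt p) (pt s) \<subseteq> {pt p}"
  proof
    fix z assume z: "z \<in> closed_segment (pt p) (pt q) \<inter> closed_segment (pt p) (pt s)"
    let ?L = "of_int (fst q - fst p) * (Im z - of_int (snd p)) - of_int (snd q - snd p) * (Re z - of_int (fst p))"
    from z obtain v where "?L = (1 - v) * of_int (orient p q p) + v * of_int (orient p q q)"
      using closed_segment_orient[of z p q] by blast
    then have "?L = 0" by simp
    moreover from z obtain u where u: "?L = (1 - u) * of_int (orient p q p) + u * of_int (orient p q s)"
        "z = (1 - u) *\<^sub>R pt p + u *\<^sub>R pt s"
      using closed_segment_orient[of z p s] by (metis IntD2)
    ultimately have "u = 0" using assms by simp
    then show "z \<in> {pt p}" using u(2) by simp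
  qed
qed auto

lemma segments_ok_Int:
  assumes "segments_ok (p, q) (r, s)" "p \<noteq> q" "r \<noteq> s"
  shows "closed_segment (pt p) (pt q) \<inter> closed_segment (pt r) (pt s) = pt ` ({p, q} \<inter> {r, s})"
proof -
  consider "p = r" "orient p q s \<noteq> 0" | "p = s" "orient p q r \<noteq> 0"
    | "q = r" "orient q p s \<noteq> 0" | "q = s" "orient q p r \<noteq> 0"
    | "{p, q} \<inter> {r, s} = {}" "same_side p q r s \<or> same_side r s p q"
    using assms(1) by (auto split: if_splits)
  then show ?thesis
  proof cases
    case 1
    then have i: "{p, q} \<inter> {r, s} = {p}" using assms(2,3) by auto
    show ?thesis unfolding i using orient_common_end[of p q s] 1 by simp
  next
    case 2
    then have i: "{p, q} \<inter> {r, s} = {p}" using assms(2,3) by auto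
    show ?thesis unfolding i using orient_common_end[of p q r] 2 by (simp add: closed_segment_commute)
  next
    case 3
    then have i: "{p, q} \<inter> {r, s} = {q}" using assms(2,3) by auto
    show ?thesis unfolding i using orient_common_end[of q p s] 3 by (simp add: closed_segment_commute)
  next
    case 4
    then have i: "{p, q} \<inter> {r, s} = {q}" using assms(2,3) by auto
    show ?thesis unfolding i using orient_common_end[of q p r] 4 by (simp add: closed_segment_commute)
  next
    case 5
    then show ?thesis using same_side_disjoint[of p q r s] same_side_disjoint[of r s p q] by auto
  qed
qed

text \<open>Vertices 0, 2, 1, 3 form the outer square of the cuboctahedron, 8 to 11 the inner one and 4 to 7 the layer
  between them; 12 to 19 are the vertices stacked into the triangles. The copies are glued at the vertices 0 and 1.\<close>

definition gadget_points :: "ipt list" where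
  "gadget_points =
    [(0, 12), (0, -12), (12, 0), (-12, 0), (5, 5), (-5, 5), (-5, -5), (5, -5), (2, 0), (0, 2),
     (-2, 0), (0, -2), (5, 6), (-6, 5), (-5, -6), (6, -5), (2, 1), (-1, 2), (-2, -1), (1, -2)]"

definition gadget_nbrs :: "nat list list" where
  "gadget_nbrs =
    [[2, 3, 4, 5, 12, 13], [2, 3, 6, 7, 14, 15], [0, 1, 4, 7, 12, 15], [0, 1, 5, 6, 13, 14],
     [0, 2, 8, 9, 12, 16], [0, 3, 9, 10, 13, 17], [1, 3, 10, 11, 14, 18], [1, 2, 8, 11, 15,
     19], [4, 7, 9, 11, 16, 19], [4, 5, 8, 10, 16, 17], [5, 6, 9, 11, 17, 18], [6, 7, 8, 10,
     18, 19], [0, 2, 4], [0, 3, 5], [1, 3, 6], [1, 2, 7], [4, 8, 9], [5, 9, 10], [6, 10, 11],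
     [7, 8, 11]]"

definition gadget_adj :: "nat \<Rightarrow> nat \<Rightarrow> bool" where
  "gadget_adj a b \<longleftrightarrow> a < 20 \<and> b \<in> set (gadget_nbrs ! a)"

definition gadget_edges :: "(nat \<times> nat) list" where
  "gadget_edges = concat (map (\<lambda>a. map (Pair a) (filter ((<) a) (gadget_nbrs ! a))) [0..<20])"

definition gadget_segments :: "(ipt \<times> ipt) list" where
  "gadget_segments = map (\<lambda>(a, b). (gadget_points ! a, gadget_points ! b)) gadget_edges"

text \<open>Planarity of the straight-line drawing by computation: \<open>sorted_wrt\<close> tests
  every two segments once, in list order.\<close>

lemma gadget_segments_ok: "sorted_wrt segments_ok gadget_segments"
  by code_simp

lemma gadget_points_facts:
  "length gadget_points = 20" "distinct gadget_points"
  "\<forall>q\<in>set gadget_points. \<bar>fst q\<bar> + \<bar>snd q\<bar> \<le> 12"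
  "gadget_points ! 0 = (0, 12)" "gadget_points ! 1 = (0, - 12)"
  by (simp_all add: gadget_points_def)

lemma gadget_edges_facts: "length gadget_edges = 48" "distinct gadget_edges"
  by code_simp+

text \<open>The clause \<open>2 \<le> a \<or> 2 \<le> b\<close> keeps the glued vertices 0 and 1
  nonadjacent, so that different copies share no edge. Nonempty lists put every vertex on an edge,
  which \<open>gadget_pos_on_seg\<close> relies on.\<close>

lemma gadget_nbrs_facts:
  "\<forall>a\<in>set [0..<20]. gadget_nbrs ! a \<noteq> [] \<and>
     (\<forall>b\<in>set (gadget_nbrs ! a). b < 20 \<and> a \<noteq> b \<and> (2 \<le> a \<or> 2 \<le> b) \<and> a \<in> set (gadget_nbrs ! b))"
  by code_simp

text \<open>An edge of the cuboctahedron lies in just one of its triangles, so its common neighbours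
  are the third corner and the vertex stacked there. For an edge to a stacked vertex they are the
  other two corners.\<close>

lemma gadget_theta:
  "\<forall>x\<in>set [0..<20]. \<forall>y\<in>set (gadget_nbrs ! x).
     \<forall>z\<in>set (filter (\<lambda>z. z \<in> set (gadget_nbrs ! y)) (gadget_nbrs ! x)).
     \<forall>a\<in>set (filter (\<lambda>z. z \<in> set (gadget_nbrs ! y)) (gadget_nbrs ! x)).
       a = z \<or> a \<in> set (gadget_nbrs ! z)"
  by code_simp
lemma gadget_adj_bounds:
  assumes "gadget_adj a b"
  shows "a < 20" "b < 20" "a \<noteq> b" "2 \<le> a \<or> 2 \<le> b"
  using assms gadget_nbrs_facts[THEN bspec, of a] by (auto simp: gadget_adj_def)

lemma gadget_adj_sym: "gadget_adj a b \<Longrightarrow> gadget_adj b a"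
  using gadget_nbrs_facts[THEN bspec, of a] gadget_adj_bounds(2)[of a b]
  by (auto simp: gadget_adj_def)

lemma gadget_adj_ex: "a < 20 \<Longrightarrow> \<exists>b. gadget_adj a b"
  using gadget_nbrs_facts[THEN bspec, of a] by (auto simp: gadget_adj_def ex_in_conv)

lemma gadget_adj_theta:
  assumes "gadget_adj x y" "gadget_adj y z" "gadget_adj z x" "gadget_adj x a" "gadget_adj y a" "a \<noteq> z"
  shows "gadget_adj z a"
  using gadget_theta[THEN bspec, THEN bspec, THEN bspec, THEN bspec, of x y z a] assms
    gadget_adj_sym[OF assms(3)]
  by (auto simp: gadget_adj_def)

lemma gadget_edges_iff: "(a, b) \<in> set gadget_edges \<longleftrightarrow> gadget_adj a b \<and> a < b"
  by (auto simp: gadget_edges_def gadget_adj_def)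

definition gadget_pos :: "nat \<Rightarrow> complex" where
  "gadget_pos j = pt (gadget_points ! j)"

definition gadget_seg :: "nat \<Rightarrow> nat \<Rightarrow> complex set" where
  "gadget_seg a b = closed_segment (gadget_pos a) (gadget_pos b)"

lemma inj_gadget_pos: "inj_on gadget_pos {..<20}"
proof -
  have "inj_on ((!) gadget_points) {..<20}"
    using gadget_points_facts(1,2) by (auto simp: inj_on_def nth_eq_iff_index_eq)
  then have "inj_on (pt \<circ> (!) gadget_points) {..<20}"
    using inj_pt by (intro comp_inj_on) (auto intro: inj_on_subset)
  then show ?thesis by (simp add: gadget_pos_def comp_def inj_on_def)
qed

lemma gadget_pos_eq_iff: "a < 20 \<Longrightarrow> b < 20 \<Longrightarrow> gadget_pos a = gadget_pos b \<longleftrightarrow> a = b"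
  using inj_gadget_pos by (auto dest: inj_onD)

lemma sorted_wrt_either:
  "sorted_wrt R xs \<Longrightarrow> x \<in> set xs \<Longrightarrow> y \<in> set xs \<Longrightarrow> x \<noteq> y \<Longrightarrow> R x y \<or> R y x"
  by (induction xs) auto

lemma gadget_seg_commute: "gadget_seg a b = gadget_seg b a"
  by (simp add: gadget_seg_def closed_segment_commute)

lemma gadget_seg_Int:
  assumes "gadget_adj a b" "gadget_adj c d" "{a, b} \<noteq> {c, d}"
  shows "gadget_seg a b \<inter> gadget_seg c d = gadget_pos ` ({a, b} \<inter> {c, d})"
proof -
  \<comment> \<open>\<open>gadget_segments\<close> lists each edge with its smaller end first, so
    the ends are ordered that way to begin with.\<close>
  have main: "gadget_seg a b \<inter> gadget_seg c d = gadget_pos ` ({a, b} \<inter> {c, d})"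
    if "gadget_adj a b" "gadget_adj c d" "{a, b} \<noteq> {c, d}" "a < b" "c < d" for a b c d
  proof -
    let ?q = "(!) gadget_points"
    have lt: "a < 20" "b < 20" "c < 20" "d < 20" using that gadget_adj_bounds by blast+
    have inj: "?q i = ?q j \<longleftrightarrow> i = j" if "i < 20" "j < 20" for i j
      using that gadget_points_facts(1,2) by (simp add: nth_eq_iff_index_eq)
    have "(?q a, ?q b) \<in> set gadget_segments" "(?q c, ?q d) \<in> set gadget_segments"
      using that gadget_edges_iff unfolding gadget_segments_def by force+
    moreover have "(?q a, ?q b) \<noteq> (?q c, ?q d)" using that(3) lt inj by auto
    ultimately have "segments_ok (?q a, ?q b) (?q c, ?q d) \<or> segments_ok (?q c, ?q d) (?q a, ?q b)"
      by (rule sorted_wrt_either[OF gadget_segments_ok])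
    moreover have "?q a \<noteq> ?q b" "?q c \<noteq> ?q d" using that(4,5) lt inj by auto
    ultimately have "gadget_seg a b \<inter> gadget_seg c d = pt ` ({?q a, ?q b} \<inter> {?q c, ?q d})"
      using segments_ok_Int[of "?q a" "?q b" "?q c" "?q d"] segments_ok_Int[of "?q c" "?q d" "?q a" "?q b"]
      unfolding gadget_seg_def gadget_pos_def by (auto simp: Int_commute)
    also have "\<dots> = pt ` ?q ` ({a, b} \<inter> {c, d})"
      using lt inj by auto
    finally show ?thesis by (simp add: image_image gadget_pos_def)
  qed
  have "a < b \<or> b < a" "c < d \<or> d < c" using gadget_adj_bounds(3) assms by force+
  then show ?thesis
    using main[of a b c d] main[of b a c d] main[of a b d c] main[of b a d c] assms
      gadget_adj_sym[OF assms(1)] gadget_adj_sym[OF assms(2)]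
    by (simp add: gadget_seg_commute[of b a] gadget_seg_commute[of d c] insert_commute) metis
qed

text \<open>The vertex \<open>j\<close> lies on some edge of its own, and different edges meet only
  in common ends.\<close>

lemma gadget_pos_on_seg:
  assumes "gadget_adj a b" "j < 20" "gadget_pos j \<in> gadget_seg a b"
  shows "j = a \<or> j = b"
proof (rule ccontr)
  assume neg: "\<not> ?thesis"
  obtain c where c: "gadget_adj j c" using gadget_adj_ex[OF assms(2)] by blast
  have "gadget_pos j \<in> gadget_seg j c" by (simp add: gadget_seg_def)
  then have "gadget_pos j \<in> gadget_pos ` ({a, b} \<inter> {j, c})"
    using gadget_seg_Int[OF assms(1) c] assms(3) neg by blast
  then have "j \<in> {a, b}"
    using gadget_pos_eq_iff gadget_adj_bounds[OF assms(1)] assms(2) by auto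
  then show False using neg by simp
qed

section \<open>Sheared copies of the gadget inside its outer square\<close>

definition kite :: "complex set" where
  "kite = {z. \<bar>Re z\<bar> + \<bar>Im z\<bar> \<le> 12}"

lemma convex_kite: "convex kite"
proof (rule convexI)
  fix x y :: complex and u v :: real
  assume *: "x \<in> kite" "y \<in> kite" "0 \<le> u" "0 \<le> v" "u + v = 1"
  have "\<bar>u * Re x + v * Re y\<bar> + \<bar>u * Im x + v * Im y\<bar>
      \<le> (u * \<bar>Re x\<bar> + v * \<bar>Re y\<bar>) + (u * \<bar>Im x\<bar> + v * \<bar>Im y\<bar>)"
    using *(3,4) by (intro add_mono order.trans[OF abs_triangle_ineq]) (simp_all add: abs_mult)
  also have "\<dots> = u * (\<bar>Re x\<bar> + \<bar>Im x\<bar>) + v * (\<bar>Re y\<bar> + \<bar>Im y\<bar>)" by (simp add: algebra_simps)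
  also have "\<dots> \<le> u * 12 + v * 12"
    using * by (intro add_mono mult_left_mono) (auto simp: kite_def)
  also have "\<dots> = 12" using *(5) by (simp flip: distrib_right)
  finally show "u *\<^sub>R x + v *\<^sub>R y \<in> kite" by (simp add: kite_def)
qed

lemma gadget_pos_kite: "j < 20 \<Longrightarrow> gadget_pos j \<in> kite"
proof -
  assume "j < 20"
  then have "gadget_points ! j \<in> set gadget_points" using gadget_points_facts(1) by simp
  then have "\<bar>fst (gadget_points ! j)\<bar> + \<bar>snd (gadget_points ! j)\<bar> \<le> 12"
    using gadget_points_facts(3) by blast
  then have "of_int (\<bar>fst (gadget_points ! j)\<bar> + \<bar>snd (gadget_points ! j)\<bar>) \<le> (of_int 12 :: real)"
    by (rule of_int_le_iff[THEN iffD2])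
  then show ?thesis by (simp add: kite_def gadget_pos_def pt_def)
qed

lemma gadget_seg_kite: "gadget_adj a b \<Longrightarrow> gadget_seg a b \<subseteq> kite"
  unfolding gadget_seg_def
  using gadget_adj_bounds by (intro closed_segment_subset gadget_pos_kite convex_kite) auto

text \<open>The \<open>i\<close>-th copy of the drawing: the kite is sheared so that its image meets the other images only in
  the points \<open>\<plusminus>12 \<i>\<close>, which are fixed.\<close>

definition shift :: "nat \<Rightarrow> complex \<Rightarrow> complex" where
  "shift i z = z + of_real (3 * real i * (12 - \<bar>Im z\<bar>))"

lemma Im_shift [simp]: "Im (shift i z) = Im z" by (simp add: shift_def)

lemma inj_shift: "inj (shift i)"
proof (rule injI)
  fix x y assume *: "shift i x = shift i y"
  then have "Im x = Im y" by (metis Im_shift)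
  with * show "x = y" by (simp add: shift_def)
qed

lemma continuous_on_shift: "continuous_on S (shift i)"
  unfolding shift_def by (intro continuous_intros)

lemma shift_0_1 [simp]: "shift i (gadget_pos 0) = gadget_pos 0" "shift i (gadget_pos (Suc 0)) = gadget_pos (Suc 0)"
  using gadget_points_facts(4,5) by (simp_all add: shift_def gadget_pos_def pt_def)

text \<open>At height \<open>Im x\<close> the kite reaches from \<open>- h\<close> to
  \<open>h\<close>, while the translations of two copies differ by at least \<open>3 * h\<close>.
  Hence \<open>h = 0\<close>, which leaves only the two tips.\<close>

lemma shift_collision:
  assumes "x \<in> kite" "y \<in> kite" "shift i x = shift j y" "i \<noteq> j"
  shows "x = y" "x = gadget_pos 0 \<or> x = gadget_pos 1"
proof -
  have Im: "Im x = Im y" using assms(3) by (metis Im_shift)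
  define h where "h = 12 - \<bar>Im x\<bar>"
  have Re: "Re x + 3 * real i * h = Re y + 3 * real j * h"
    using arg_cong[OF assms(3), of Re] Im by (simp add: shift_def h_def)
  have b: "\<bar>Re x\<bar> \<le> h" "\<bar>Re y\<bar> \<le> h" using assms(1,2) Im by (auto simp: kite_def h_def)
  have "h = 0"
  proof (rule ccontr)
    assume "h \<noteq> 0"
    then have "h > 0" using b by linarith
    consider "real i \<ge> real j + 1" | "real j \<ge> real i + 1" using assms(4) by linarith
    then show False
    proof cases
      case 1
      then have "real i * h \<ge> (real j + 1) * h" using \<open>h > 0\<close> by (intro mult_right_mono) auto
      then show False using Re b \<open>h > 0\<close> by (simp add: algebra_simps)
    next
      case 2
      then have "real j * h \<ge> (real i + 1) * h" using \<open>h > 0\<close> by (intro mult_right_mono) auto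
      then show False using Re b \<open>h > 0\<close> by (simp add: algebra_simps)
    qed
  qed
  then have x: "Re x = 0" "Re y = 0" "\<bar>Im x\<bar> = 12" using b by (auto simp: h_def)
  then show "x = y" using Im by (simp add: complex_eq_iff)
  show "x = gadget_pos 0 \<or> x = gadget_pos 1"
    using x gadget_points_facts(4,5) by (auto simp: complex_eq_iff gadget_pos_def pt_def abs_if split: if_splits)
qed

section \<open>Vertices and edges of the glued copies\<close>

text \<open>Copy \<open>i\<close> keeps the glued vertices 0 and 1 and takes the 18 numbers from
  \<open>18 * i + 2\<close> on for the others, so \<open>k \<ge> 1\<close> copies fill
  \<open>{..<18 * k + 2}\<close>.\<close>

definition copy :: "nat \<Rightarrow> nat \<Rightarrow> nat" where
  "copy i j = (if j < 2 then j else 18 * i + j)"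

definition copy_base :: "nat \<Rightarrow> nat" where
  "copy_base v = (if v < 2 then v else (v - 2) mod 18 + 2)"

text \<open>For the glued vertices truncated subtraction gives index 0; this is harmless because
  every shift fixes their positions.\<close>

definition copy_index :: "nat \<Rightarrow> nat" where
  "copy_index v = (v - 2) div 18"

lemma copy_base_copy [simp]: "j < 20 \<Longrightarrow> copy_base (copy i j) = j"
proof -
  assume "j < 20"
  show ?thesis
  proof (cases "j < 2")
    case False
    then obtain l where "j = l + 2" by (metis add.commute le_Suc_ex not_less)
    then show ?thesis using \<open>j < 20\<close> by (simp add: copy_base_def copy_def)
  qed (simp add: copy_base_def copy_def)
qed

lemma copy_index_copy [simp]: "2 \<le> j \<Longrightarrow> j < 20 \<Longrightarrow> copy_index (copy i j) = i"
proof -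
  assume j: "2 \<le> j" "j < 20"
  then have "18 * i + j - 2 = 18 * i + (j - 2)" "(j - 2) div 18 = 0" by (auto simp: div_less)
  then show ?thesis using j by (simp add: copy_index_def copy_def)
qed

lemma copy_index_base: "copy (copy_index v) (copy_base v) = v"
  by (auto simp: copy_def copy_index_def copy_base_def)

lemma copy_base_less: "copy_base v < 20"
  using mod_less_divisor[of 18 "v - 2"] by (simp add: copy_base_def)

lemma copy_ge_2 [simp]: "2 \<le> copy i j \<longleftrightarrow> 2 \<le> j" by (auto simp: copy_def)

definition necklace_edges :: "nat \<Rightarrow> nat set set" where
  "necklace_edges k = {{copy i a, copy i b} | i a b. i < k \<and> gadget_adj a b}"

lemma necklace_edgeE:
  assumes "{s, t} \<in> necklace_edges k"
  obtains i a b where "i < k" "gadget_adj a b" "s = copy i a" "t = copy i b"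
proof -
  obtain i a b where "i < k" "gadget_adj a b" "{s, t} = {copy i a, copy i b}"
    using assms by (auto simp: necklace_edges_def)
  then show ?thesis using that[of i a b] that[of i b a] gadget_adj_sym by (auto simp: doubleton_eq_iff)
qed

lemma copy_less: "i < k \<Longrightarrow> j < 20 \<Longrightarrow> copy i j < 18 * k + 2"
proof -
  assume "i < k" "j < 20"
  then have "18 * i + 18 \<le> 18 * k" by simp
  then show ?thesis using \<open>j < 20\<close> by (simp add: copy_def)
qed

lemma copy_eqD: "copy i a = copy i b \<Longrightarrow> a < 20 \<Longrightarrow> b < 20 \<Longrightarrow> a = b"
  by (metis copy_base_copy)

lemma simple_necklace: "simple_graph {..<18 * k + 2} (necklace_edges k)"
  unfolding simple_graph_def
proof (intro conjI ballI)
  fix e assume "e \<in> necklace_edges k"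
  then obtain i a b where *: "i < k" "gadget_adj a b" "e = {copy i a, copy i b}"
    by (auto simp: necklace_edges_def)
  then show "e \<subseteq> {..<18 * k + 2}" using copy_less gadget_adj_bounds by simp
  have "copy i a \<noteq> copy i b" using *(2) copy_eqD gadget_adj_bounds by blast
  then show "card e = 2" using *(3) by simp
qed simp

text \<open>The larger end of a gadget edge is at least 2 and so determines the copy; the 48 edges
  of each of the \<open>k\<close> copies are therefore all different.\<close>

lemma card_necklace_edges: "card (necklace_edges k) = 48 * k"
proof -
  let ?f = "\<lambda>(i, a, b). {copy i a, copy i b}"
  have eq: "necklace_edges k = ?f ` ({..<k} \<times> set gadget_edges)"
  proof
    show "necklace_edges k \<subseteq> ?f ` ({..<k} \<times> set gadget_edges)"
    proof
      fix e assume "e \<in> necklace_edges k"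
      then obtain i a b where *: "i < k" "gadget_adj a b" "e = {copy i a, copy i b}"
        by (auto simp: necklace_edges_def)
      then consider "(a, b) \<in> set gadget_edges" | "(b, a) \<in> set gadget_edges"
        using gadget_edges_iff gadget_adj_sym gadget_adj_bounds(3) by (metis linorder_neqE_nat)
      then show "e \<in> ?f ` ({..<k} \<times> set gadget_edges)"
      proof cases
        case 1 then show ?thesis using * by (intro image_eqI[of _ _ "(i, a, b)"]) auto
      next
        case 2 then show ?thesis using * by (intro image_eqI[of _ _ "(i, b, a)"]) auto
      qed
    qed
    show "?f ` ({..<k} \<times> set gadget_edges) \<subseteq> necklace_edges k"
      unfolding necklace_edges_def by (clarsimp simp: gadget_edges_iff) blast
  qed
  have "inj_on ?f ({..<k} \<times> set gadget_edges)"
  proof (rule inj_onI)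
    fix s t assume st: "s \<in> {..<k} \<times> set gadget_edges" "t \<in> {..<k} \<times> set gadget_edges" "?f s = ?f t"
    obtain i a b where s: "s = (i, a, b)" by (rule prod_cases3)
    obtain i' a' b' where t: "t = (i', a', b')" by (rule prod_cases3)
    have e: "(a, b) \<in> set gadget_edges" "(a', b') \<in> set gadget_edges"
      and *: "{copy i a, copy i b} = {copy i' a', copy i' b'}"
      using st unfolding s t by auto
    have adj: "gadget_adj a b" "gadget_adj a' b'" "a < b" "a' < b'" using e by (auto simp: gadget_edges_iff)
    note bd = gadget_adj_bounds[OF adj(1)] gadget_adj_bounds[OF adj(2)]
    from * consider "copy i a = copy i' a'" "copy i b = copy i' b'"
      | "copy i a = copy i' b'" "copy i b = copy i' a'" by (auto simp: doubleton_eq_iff)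
    then show "s = t"
    proof cases
      case 1
      then have "a = a'" "b = b'" using bd by (metis copy_base_copy)+
      moreover have "2 \<le> b" using bd(4) adj(3) by linarith
      moreover have "i = i'" using 1(2) \<open>b = b'\<close> \<open>2 \<le> b\<close> bd by (metis copy_index_copy)
      ultimately show ?thesis using s t by simp
    next
      case 2
      then have "a = b'" "b = a'" using bd by (metis copy_base_copy)+
      then show ?thesis using adj by simp
    qed
  qed
  then have "card (necklace_edges k) = card ({..<k} \<times> set gadget_edges)"
    unfolding eq by (rule card_image)
  then show ?thesis using gadget_edges_facts by (simp add: card_cartesian_product distinct_card)
qed

text \<open>One of \<open>x\<close>, \<open>y\<close> is not glued. It lies in a single copy, and
  all its neighbours, in particular \<open>z\<close> and \<open>a\<close>, are vertices of that
  copy; the claim is then that of the gadget.\<close>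

lemma theta_closed_necklace: "theta_closed (necklace_edges k)"
  unfolding theta_closed_def
proof (intro allI impI)
  have adj: "gadget_adj (copy_base s) (copy_base t)" "2 \<le> s \<or> 2 \<le> t"
    "2 \<le> s \<Longrightarrow> copy_index s < k \<and> t = copy (copy_index s) (copy_base t)"
    if st: "{s, t} \<in> necklace_edges k" for s t
  proof -
    obtain i a b where *: "i < k" "gadget_adj a b" "s = copy i a" "t = copy i b"
      by (rule necklace_edgeE[OF st])
    note bd = gadget_adj_bounds[OF *(2)]
    show "gadget_adj (copy_base s) (copy_base t)" using * bd by simp
    show "2 \<le> s \<or> 2 \<le> t" using * bd by simp
    show "copy_index s < k \<and> t = copy (copy_index s) (copy_base t)" if "2 \<le> s"
      using that * bd by simp
  qed
  fix x y z a
  assume E: "{x, y} \<in> necklace_edges k" "{y, z} \<in> necklace_edges k" "{z, x} \<in> necklace_edges k"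
    "{x, a} \<in> necklace_edges k" "{y, a} \<in> necklace_edges k" and "a \<noteq> z"
  have E': "{y, x} \<in> necklace_edges k" "{x, z} \<in> necklace_edges k"
    using E by (simp_all add: insert_commute)
  obtain i where i: "i < k" "z = copy i (copy_base z)" "a = copy i (copy_base a)"
    using adj(2)[OF E(1)] adj(3)[OF E'(2)] adj(3)[OF E(4)] adj(3)[OF E(2)] adj(3)[OF E(5)] by blast
  then have "copy_base a \<noteq> copy_base z" using \<open>a \<noteq> z\<close> by metis
  then have "gadget_adj (copy_base z) (copy_base a)"
    by (rule gadget_adj_theta[OF E[THEN adj(1)]])
  then have "{copy i (copy_base z), copy i (copy_base a)} \<in> necklace_edges k"
    using i(1) unfolding necklace_edges_def by blast
  then show "{z, a} \<in> necklace_edges k"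
    by (simp only: i(2,3)[symmetric])
qed

definition necklace_pos :: "nat \<Rightarrow> complex" where
  "necklace_pos v = shift (copy_index v) (gadget_pos (copy_base v))"

lemma necklace_pos_copy [simp]:
  assumes "j < 20" shows "necklace_pos (copy i j) = shift i (gadget_pos j)"
proof (cases "2 \<le> j")
  case True
  then show ?thesis using assms by (simp add: necklace_pos_def)
next
  case False
  then have "j = 0 \<or> j = Suc 0" by auto
  then show ?thesis using assms by (auto simp: necklace_pos_def copy_base_def copy_def)
qed

text \<open>An edge of the necklace determines its copy and its two ends there; \<open>SOME\<close>
  only picks the direction of the arc.\<close>

definition necklace_arc :: "nat \<Rightarrow> nat set \<Rightarrow> real \<Rightarrow> complex" where
  "necklace_arc k e = (case (SOME (i, a, b). i < k \<and> gadget_adj a b \<and> e = {copy i a, copy i b}) of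
     (i, a, b) \<Rightarrow> shift i \<circ> linepath (gadget_pos a) (gadget_pos b))"

lemma necklace_arcE:
  assumes "e \<in> necklace_edges k"
  obtains i a b where "i < k" "gadget_adj a b" "e = {copy i a, copy i b}"
    "necklace_arc k e = shift i \<circ> linepath (gadget_pos a) (gadget_pos b)"
    "path_image (necklace_arc k e) = shift i ` gadget_seg a b"
proof -
  let ?P = "\<lambda>(i, a, b). i < k \<and> gadget_adj a b \<and> e = {copy i a, copy i b}"
  have "\<exists>t. ?P t" using assms by (auto simp: necklace_edges_def)
  then have "?P (SOME t. ?P t)" by (rule someI_ex)
  moreover obtain i a b where t: "(SOME t. ?P t) = (i, a, b)" by (rule prod_cases3)
  ultimately have P: "?P (i, a, b)" by (simp only:)
  have arc: "necklace_arc k e = shift i \<circ> linepath (gadget_pos a) (gadget_pos b)"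
    unfolding necklace_arc_def t by simp
  have "path_image (necklace_arc k e) = shift i ` gadget_seg a b"
    unfolding arc by (simp add: path_image_compose gadget_seg_def)
  with P arc show ?thesis by (intro that[of i a b]) auto
qed

text \<open>Within one copy \<open>shift\<close> is injective. Different copies collide only in the
  tips, where \<open>copy\<close> does not depend on the index.\<close>

lemma shifted_vertex_on_seg:
  assumes "gadget_adj a b" "x \<in> gadget_seg a b" "shift i x = shift i' (gadget_pos j)" "j < 20"
  shows "x = gadget_pos j \<and> j \<in> {a, b} \<and> copy i' j = copy i j"
proof -
  have kite: "x \<in> kite" "gadget_pos j \<in> kite"
    using gadget_seg_kite[OF assms(1)] assms(2) gadget_pos_kite[OF assms(4)] by auto
  have x: "x = gadget_pos j \<and> (i = i' \<or> j < 2)"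
  proof (cases "i = i'")
    case True then show ?thesis using assms(3) inj_shift by (auto dest: injD)
  next
    case False
    have "x = gadget_pos j" "x = gadget_pos 0 \<or> x = gadget_pos 1"
      using shift_collision[OF kite assms(3) False] by auto
    then show ?thesis using gadget_pos_eq_iff[of j 0] gadget_pos_eq_iff[of j 1] assms(4) by auto
  qed
  then have "j \<in> {a, b}" using gadget_pos_on_seg[OF assms(1,4)] assms(2) by blast
  with x show ?thesis by (auto simp: copy_def)
qed

lemma necklace_drawing:
  "plane_drawing {..<18 * k + 2} (necklace_edges k) necklace_pos (necklace_arc k)"
  unfolding plane_drawing_def
proof (intro conjI ballI impI)
  show "inj_on necklace_pos {..<18 * k + 2}"
  proof (rule inj_onI)
    fix v w assume "necklace_pos v = necklace_pos w"
    then have eq: "shift (copy_index v) (gadget_pos (copy_base v)) = shift (copy_index w) (gadget_pos (copy_base w))"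
      by (simp add: necklace_pos_def)
    \<comment> \<open>An edge at \<open>copy_base v\<close> turns this vertex into a point of a
      segment, so that \<open>shifted_vertex_on_seg\<close> applies.\<close>
    obtain c where c: "gadget_adj (copy_base v) c" using gadget_adj_ex[OF copy_base_less] by blast
    have "gadget_pos (copy_base v) \<in> gadget_seg (copy_base v) c" by (simp add: gadget_seg_def)
    then have "gadget_pos (copy_base v) = gadget_pos (copy_base w)"
      "copy (copy_index w) (copy_base w) = copy (copy_index v) (copy_base w)"
      using shifted_vertex_on_seg[OF c _ eq copy_base_less] by auto
    then have "copy_base v = copy_base w" "w = copy (copy_index v) (copy_base w)"
      using gadget_pos_eq_iff copy_base_less copy_index_base by auto
    then show "v = w" using copy_index_base[of v] by simp
  qed
next
  fix e assume "e \<in> necklace_edges k"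
  then obtain i a b where e: "i < k" "gadget_adj a b" "e = {copy i a, copy i b}"
    "necklace_arc k e = shift i \<circ> linepath (gadget_pos a) (gadget_pos b)"
    "path_image (necklace_arc k e) = shift i ` gadget_seg a b"
    by (rule necklace_arcE)
  note bd = gadget_adj_bounds[OF e(2)]
  have "gadget_pos a \<noteq> gadget_pos b" using gadget_pos_eq_iff bd by simp
  then have "arc (linepath (gadget_pos a) (gadget_pos b))" by (rule arc_linepath)
  then show "arc (necklace_arc k e)"
    unfolding e(4) arc_def
    by (auto intro!: path_continuous_image continuous_on_shift comp_inj_on inj_on_subset[OF inj_shift])
  have "{pathstart (necklace_arc k e), pathfinish (necklace_arc k e)}
      = {shift i (gadget_pos a), shift i (gadget_pos b)}"
    unfolding e(4) by (simp add: pathstart_compose pathfinish_compose)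
  also have "\<dots> = necklace_pos ` e" unfolding e(3) using bd by simp
  finally show ends: "{pathstart (necklace_arc k e), pathfinish (necklace_arc k e)} = necklace_pos ` e" .
  show "path_image (necklace_arc k e) \<inter> necklace_pos ` {..<18 * k + 2} = necklace_pos ` e"
  proof
    show "path_image (necklace_arc k e) \<inter> necklace_pos ` {..<18 * k + 2} \<subseteq> necklace_pos ` e"
    proof
      fix z assume "z \<in> path_image (necklace_arc k e) \<inter> necklace_pos ` {..<18 * k + 2}"
      then obtain x v where x: "x \<in> gadget_seg a b" "z = shift i x" "z = necklace_pos v"
        unfolding e(5) by auto
      then have "shift i x = shift (copy_index v) (gadget_pos (copy_base v))"
        by (simp add: necklace_pos_def)
      then have "copy_base v \<in> {a, b}" "copy (copy_index v) (copy_base v) = copy i (copy_base v)"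
        using shifted_vertex_on_seg[OF e(2) x(1) _ copy_base_less] by auto
      then have "v \<in> e" using copy_index_base[of v] e(3) by auto
      then show "z \<in> necklace_pos ` e" using x(3) by blast
    qed
    have "e \<subseteq> {..<18 * k + 2}" using \<open>e \<in> necklace_edges k\<close> simple_necklace by (auto simp: simple_graph_def)
    moreover have "necklace_pos ` e \<subseteq> path_image (necklace_arc k e)"
      using ends pathstart_in_path_image pathfinish_in_path_image by (metis insert_subset empty_subsetI)
    ultimately show "necklace_pos ` e \<subseteq> path_image (necklace_arc k e) \<inter> necklace_pos ` {..<18 * k + 2}"
      by blast
  qed
next
  fix e f assume ef: "e \<in> necklace_edges k" "f \<in> necklace_edges k" "e \<noteq> f"
  obtain i a b where e: "i < k" "gadget_adj a b" "e = {copy i a, copy i b}"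
    "path_image (necklace_arc k e) = shift i ` gadget_seg a b"
    by (rule necklace_arcE[OF ef(1)])
  obtain j c d where f: "j < k" "gadget_adj c d" "f = {copy j c, copy j d}"
    "path_image (necklace_arc k f) = shift j ` gadget_seg c d"
    by (rule necklace_arcE[OF ef(2)])
  note bd = gadget_adj_bounds[OF e(2)] gadget_adj_bounds[OF f(2)]
  have sub: "necklace_pos ` {copy i a, copy i b} \<subseteq> shift i ` gadget_seg a b" if "gadget_adj a b" for i a b
    using gadget_adj_bounds[OF that] by (auto simp: gadget_seg_def)
  show "path_image (necklace_arc k e) \<inter> path_image (necklace_arc k f) = necklace_pos ` (e \<inter> f)"
  proof
    show "necklace_pos ` (e \<inter> f) \<subseteq> path_image (necklace_arc k e) \<inter> path_image (necklace_arc k f)"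
      unfolding e(4) f(4)
      using sub[OF e(2), of i, folded e(3)] sub[OF f(2), of j, folded f(3)] by blast
    show "path_image (necklace_arc k e) \<inter> path_image (necklace_arc k f) \<subseteq> necklace_pos ` (e \<inter> f)"
    proof
      fix z assume "z \<in> path_image (necklace_arc k e) \<inter> path_image (necklace_arc k f)"
      then obtain x y where x: "x \<in> gadget_seg a b" "z = shift i x" and y: "y \<in> gadget_seg c d" "z = shift j y"
        unfolding e(4) f(4) by auto
      \<comment> \<open>A common point always comes from a gadget vertex: in one copy by
        \<open>gadget_seg_Int\<close>, in different copies because only the tips collide.\<close>
      obtain t where t: "t < 20" "x = gadget_pos t" "y = gadget_pos t"
      proof (cases "i = j")
        case True
        then have "x = y" using x y inj_shift by (metis injD)
        moreover have "{a, b} \<noteq> {c, d}" using ef(3) e(3) f(3) True by (auto simp: doubleton_eq_iff)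
        ultimately have "x \<in> gadget_pos ` ({a, b} \<inter> {c, d})"
          using gadget_seg_Int[OF e(2) f(2)] x(1) y(1) by blast
        then show ?thesis using that \<open>x = y\<close> bd by auto
      next
        case False
        have "x \<in> kite" "y \<in> kite" using gadget_seg_kite e(2) f(2) x(1) y(1) by auto
        then show ?thesis
          using shift_collision[of x y i j] False x(2) y(2) that[of 0] that[of 1] by auto
      qed
      have "shift j y = shift i (gadget_pos t)" using x(2) y(2) t by simp
      then have "t \<in> {c, d}" "copy i t = copy j t"
        using shifted_vertex_on_seg[OF f(2) y(1) _ t(1)] by auto
      moreover have "t \<in> {a, b}" using gadget_pos_on_seg[OF e(2) t(1)] t(2) x(1) by auto
      ultimately have "copy i t \<in> e \<inter> f" using e(3) f(3) by auto
      moreover have "z = necklace_pos (copy i t)" using x(2) t by simp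
      ultimately show "z \<in> necklace_pos ` (e \<inter> f)" by blast
    qed
  qed
qed

theorem theorem1p1:
  shows "(\<forall>n::nat. n \<ge> 5 \<longrightarrow>
            real (ex_planar_ind n theta4_verts theta4_edges) \<le> 8 / 3 * (real n - 2)) \<and>
         (\<forall>n::nat. n mod 36 = 20 \<longrightarrow>
            real (ex_planar_ind n theta4_verts theta4_edges) = 8 / 3 * (real n - 2))"
proof -
  let ?S = "\<lambda>n. planar_ind_edge_counts n theta4_verts theta4_edges"
  have bound: "real m \<le> 8 / 3 * (real n - 2)" if m: "m \<in> ?S n" and n: "5 \<le> n" for m n
  proof -
    obtain V :: "nat set" and E where E: "m = card E" "planar_graph V E" "card V = n"
        "induced_free V E theta4_verts theta4_edges"
      using m unfolding planar_ind_edge_counts_def by blast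
    then have "theta_closed E" using induced_free_theta4_iff by (auto simp: planar_graph_def)
    then have "3 * m + 16 \<le> 8 * n" using planar_theta_closed_bound[OF E(2)] E(1,3) n by simp
    then have "real (3 * m + 16) \<le> real (8 * n)" by (rule of_nat_mono)
    then show ?thesis by simp
  qed
  have upper: "real (ex_planar_ind n theta4_verts theta4_edges) \<le> 8 / 3 * (real n - 2)" if "5 \<le> n" for n
  proof -
    have "?S n \<noteq> {}"
      by (rule planar_ind_edge_counts_nonempty[OF simple_graph_theta4]) (simp add: theta4_edges_def)
    then have "ex_planar_ind n theta4_verts theta4_edges \<in> ?S n"
      unfolding ex_planar_ind_def by (intro Max_in finite_planar_ind_edge_counts)
    then show ?thesis using bound that by blast
  qed
  moreover have "real (ex_planar_ind n theta4_verts theta4_edges) = 8 / 3 * (real n - 2)"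
    if "n mod 36 = 20" for n
  proof (rule antisym)
    have "n = 36 * (n div 36) + 20" using that mult_div_mod_eq[of 36 n] by simp
    \<comment> \<open>With \<open>n = 36 q + 20\<close> one has \<open>n = 18 (2 q + 1) + 2\<close>,
      so \<open>2 q + 1\<close> copies give exactly \<open>n\<close> vertices, and
      \<open>48 k\<close> equals \<open>8 / 3 * (n - 2)\<close>.\<close>
    then obtain k where n: "n = 18 * k + 2" by (intro that[of "2 * (n div 36) + 1"]) simp
    have "5 \<le> n" using that by (cases "n < 36") auto
    then show "real (ex_planar_ind n theta4_verts theta4_edges) \<le> 8 / 3 * (real n - 2)" by (rule upper)
    have "planar_graph {..<n} (necklace_edges k)"
      unfolding planar_graph_def n using simple_necklace necklace_drawing by blast
    moreover have "induced_free {..<n} (necklace_edges k) theta4_verts theta4_edges"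
      using induced_free_theta4_iff[OF simple_necklace] theta_closed_necklace n by blast
    ultimately have "48 * k \<in> ?S n"
      unfolding planar_ind_edge_counts_def using card_necklace_edges card_lessThan
      by (metis (mono_tags, lifting) mem_Collect_eq)
    then have "48 * k \<le> ex_planar_ind n theta4_verts theta4_edges"
      unfolding ex_planar_ind_def by (intro Max_ge finite_planar_ind_edge_counts)
    then have "real (48 * k) \<le> real (ex_planar_ind n theta4_verts theta4_edges)" by (rule of_nat_mono)
    then show "8 / 3 * (real n - 2) \<le> real (ex_planar_ind n theta4_verts theta4_edges)" by (simp add: n)
  qed
  ultimately show ?thesis by blast
qed

end
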